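(* Let $G=(V,E)$ be an infinite, connected, locally finite graph, let $(\xi_t)_{t\ge0}$ be coalescing random walk on $G$ started with one particle at every vertex, and let $p_t(v)=\mathbf{P}(\xi_t(v)=1)$. Then for every vertex $v\in V$, $p_t(v)\to0$ as $t\to\infty$.
   Context: Coalescing random walk on $G=(V,E)$: each undirected edge is replaced by two directed edges, and independent unit-intensity Poisson processes (in time) are attached to the directed edges. Initially there is one particle at each vertex. When the Poisson process of the directed edge $(u,w)$ rings, any particle at $u$ moves to $w$; if there is already a particle at $w$ the two merge into one and proceed together. (So a particle at $u$ jumps at total rate $\deg u$. A particle that makes infinitely many jumps in finite time is regarded as removed.) $\xi_t\in\{0,1\}^V$ denotes the configuration of occupied vertices at time $t$: $\xi_t(v)=1$ iff $v$ is occupied at time $t$. *)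

theory Defs
  imports "HOL-Probability.Probability" "Graph_Theory.Graph_Theory"
begin

section \<open>Poisson clocks\<close>

context prob_space
begin

text \<open>
  A Poisson process of intensity \<open>r\<close> on the time axis is given by its set \<open>T \<omega>\<close> of (positive)
  ring times. The sequence \<open>\<tau>\<close> may be eventually constant, so that the last clause is independence
  of the increments over finitely many consecutive intervals.
\<close>

definition poisson_process :: "real \<Rightarrow> ('a \<Rightarrow> real set) \<Rightarrow> bool" where
  "poisson_process r T \<longleftrightarrow>
     (\<forall>\<omega>\<in>space M. T \<omega> \<subseteq> {0<..} \<and> (\<forall>t. finite (T \<omega> \<inter> {..t}))) \<and>
     (\<forall>s t. 0 \<le> s \<longrightarrow> s < t \<longrightarrow>
        distr M (count_space UNIV) (\<lambda>\<omega>. card (T \<omega> \<inter> {s<..t}))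
          = measure_pmf (poisson_pmf (r * (t - s)))) \<and>
     (\<forall>\<tau> :: nat \<Rightarrow> real. 0 \<le> \<tau> 0 \<longrightarrow> mono \<tau> \<longrightarrow>
        indep_vars (\<lambda>_. count_space UNIV) (\<lambda>i \<omega>. card (T \<omega> \<inter> {\<tau> i<..\<tau> (Suc i)})) UNIV)"

definition counting_path :: "('a \<Rightarrow> real set) \<Rightarrow> 'a \<Rightarrow> real \<Rightarrow> nat" where
  "counting_path T \<omega> = (\<lambda>t\<in>{0..}. card (T \<omega> \<inter> {0<..t}))"

definition poisson_clocks :: "'e set \<Rightarrow> ('e \<Rightarrow> 'a \<Rightarrow> real set) \<Rightarrow> bool" where
  "poisson_clocks A R \<longleftrightarrow>
     (\<forall>e\<in>A. poisson_process 1 (R e)) \<and>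
     indep_vars (\<lambda>_. Pi\<^sub>M {0..} (\<lambda>_. count_space UNIV)) (\<lambda>e. counting_path (R e)) A"

end

section \<open>Coalescing random walk\<close>

text \<open>
  An undirected simple graph is a bidirected digraph whose arcs are ordered pairs of vertices, so
  that \<open>parcs G\<close> is the set of directed edges obtained by replacing every undirected edge by two
  directed ones. For a realisation \<open>K\<close> of the clocks, \<open>K (u, w)\<close> is the set of ring times of
  \<open>(u, w)\<close>, and \<open>particle_at G K x t u\<close> says that the particle started at \<open>x\<close> is at \<open>u\<close> at time \<open>t\<close>.

  A derivation uses finitely many jumps, so a particle that has made infinitely many jumps
  by time \<open>t\<close> is nowhere at time \<open>t\<close>: it has been removed. Merging needs no rule of its own,
  because all particles at the same vertex obey the same clocks and hence move together after they
  meet. Two clocks ringing at the same time form a null event.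
\<close>

inductive particle_at ::
  "'v pair_pre_digraph \<Rightarrow> ('v \<times> 'v \<Rightarrow> real set) \<Rightarrow> 'v \<Rightarrow> real \<Rightarrow> 'v \<Rightarrow> bool"
  for G K x where
  start: "x \<in> pverts G \<Longrightarrow> particle_at G K x 0 x"
| stay: "particle_at G K x s u \<Longrightarrow> s \<le> t \<Longrightarrow>
    (\<forall>w. (u, w) \<in> parcs G \<longrightarrow> K (u, w) \<inter> {s<..t} = {}) \<Longrightarrow> particle_at G K x t u"
| jump: "particle_at G K x s u \<Longrightarrow> s < t \<Longrightarrow> (u, w) \<in> parcs G \<Longrightarrow> t \<in> K (u, w) \<Longrightarrow>
    (\<forall>w'. (u, w') \<in> parcs G \<longrightarrow> K (u, w') \<inter> {s<..<t} = {}) \<Longrightarrow> particle_at G K x t w"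

definition crw_config ::
  "'v pair_pre_digraph \<Rightarrow> ('v \<times> 'v \<Rightarrow> real set) \<Rightarrow> real \<Rightarrow> 'v \<Rightarrow> nat" where
  "crw_config G K t v = (if \<exists>x\<in>pverts G. particle_at G K x t v then 1 else 0)"

definition (in prob_space) occupation_prob ::
  "'v pair_pre_digraph \<Rightarrow> ('v \<times> 'v \<Rightarrow> 'a \<Rightarrow> real set) \<Rightarrow> real \<Rightarrow> 'v \<Rightarrow> real" where
  "occupation_prob G R t v = prob {\<omega> \<in> space M. crw_config G (\<lambda>e. R e \<omega>) t v = 1}"

definition locally_finite :: "'v pair_pre_digraph \<Rightarrow> bool" where
  "locally_finite G \<longleftrightarrow> (\<forall>v\<in>pverts G. finite (out_arcs (with_proj G) v))"

section \<open>Measurability of the occupation event\<close>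


lemma countable_pverts:
  assumes "pair_bidirected_digraph G" "Digraph_Component.connected (with_proj G)"
    "locally_finite G"
  shows "countable (pverts G)"
proof -
  interpret pair_bidirected_digraph G by fact
  have conn: "strongly_connected (mk_symmetric (with_proj G))"
    using assms(2) by (simp add: Digraph_Component.connected_def)
  have sym: "(u, w) \<in> parcs G \<Longrightarrow> (w, u) \<in> parcs G" for u w
    using pair_sym_arcs by (auto simp: symmetric_def sym_def)
  have arcs: "arcs_ends (with_proj (mk_symmetric (with_proj G))) = parcs G"
    using sym by (auto simp: parcs_mk_symmetric)
  obtain r where r: "r \<in> pverts G"
    using conn by (auto simp: strongly_connected_def)
  define B where "B n = ((\<lambda>A. A \<union> (parcs G `` A)) ^^ n) {r}" for n :: nat
  have B: "finite (B n) \<and> B n \<subseteq> pverts G" for n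
  proof (induction n)
    case 0
    then show ?case using r by (simp add: B_def)
  next
    case (Suc n)
    have "parcs G `` B n = (\<Union>u\<in>B n. snd ` out_arcs (with_proj G) u)"
      by (force simp: out_arcs_def)
    moreover have "finite \<dots>"
      using Suc assms(3) by (auto simp: locally_finite_def)
    moreover have "parcs G `` B n \<subseteq> pverts G"
      using in_arcsD2 by auto
    ultimately show ?case using Suc by (simp add: B_def)
  qed
  have "v \<in> (\<Union>n. B n)" if "v \<in> pverts G" for v
  proof -
    have "(r, v) \<in> rtrancl_on (pverts G) (parcs G)"
      using conn r that arcs unfolding strongly_connected_def reachable_def by auto
    then show ?thesis
    proof (induction rule: rtrancl_on_induct)
      case base
      have "r \<in> B 0" by (simp add: B_def)
      then show ?case by blast
    next
      case (step y z)
      then obtain n where "y \<in> B n" by blast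
      then have "z \<in> B (Suc n)" using step by (auto simp: B_def)
      then show ?case by blast
    qed
  qed
  then have "pverts G \<subseteq> (\<Union>n. B n)" by blast
  moreover have "countable (\<Union>n. B n)" using B by (auto intro: countable_finite)
  ultimately show ?thesis by (rule countable_subset)
qed

lemma (in prob_space) ring_times_measurable:
  assumes "poisson_process r T"
  obtains X :: "nat \<Rightarrow> 'a \<Rightarrow> real" where "\<And>k. X k \<in> borel_measurable M"
    and "\<And>\<omega>. \<omega> \<in> space M \<Longrightarrow> T \<omega> = {X k \<omega> | k. 0 < X k \<omega>}"
proof -
  define N where "N t \<omega> = card (T \<omega> \<inter> {0<..t})" for t \<omega>
  have pos: "T \<omega> \<subseteq> {0<..}" and fin: "finite (T \<omega> \<inter> {..t})" if "\<omega> \<in> space M" for \<omega> t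
    using assms that by (auto simp: poisson_process_def)
  have N_meas [measurable]: "N t \<in> measurable M (count_space UNIV)" for t
  proof (cases "0 \<le> t")
    case True
    define \<tau> :: "nat \<Rightarrow> real" where "\<tau> i = (if i = 0 then 0 else t)" for i
    have "mono \<tau>" "0 \<le> \<tau> 0" using True by (auto simp: \<tau>_def mono_def)
    then have "indep_vars (\<lambda>_. count_space UNIV) (\<lambda>i \<omega>. card (T \<omega> \<inter> {\<tau> i<..\<tau> (Suc i)})) UNIV"
      using assms by (simp add: poisson_process_def)
    then have "random_variable (count_space UNIV) (\<lambda>\<omega>. card (T \<omega> \<inter> {\<tau> 0<..\<tau> (Suc 0)}))"
      unfolding indep_vars_def by blast
    moreover have "(\<lambda>\<omega>. card (T \<omega> \<inter> {\<tau> 0<..\<tau> (Suc 0)})) = N t"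
      by (simp add: N_def \<tau>_def fun_eq_iff)
    ultimately show ?thesis by simp
  next
    case False
    then have "N t = (\<lambda>_. 0)" by (auto simp: N_def)
    then show ?thesis by simp
  qed
  define H where "H k \<omega> \<longleftrightarrow> (\<exists>m::nat. Suc k \<le> N (real m) \<omega>)" for k \<omega>
  have H_meas: "{\<omega> \<in> space M. H k \<omega>} \<in> sets M" for k
    unfolding H_def by measurable
  define X where "X k \<omega> = (if H k \<omega> then Inf {t \<in> T \<omega>. Suc k \<le> N t \<omega>} else 0)" for k \<omega>
  have N_mono: "N s \<omega> \<le> N t \<omega>" if "\<omega> \<in> space M" "s \<le> t" for s t \<omega>
    unfolding N_def using that
    by (intro card_mono finite_subset[OF _ fin[of \<omega> t]]) auto
  have last: "\<exists>a\<in>T \<omega>. a \<le> t \<and> N a \<omega> = N t \<omega>" if "\<omega> \<in> space M" "0 < N t \<omega>" for t \<omega>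
  proof -
    let ?A = "T \<omega> \<inter> {0<..t}"
    have f: "finite ?A" using fin[OF that(1), of t] by (rule finite_subset[rotated]) auto
    have ne: "?A \<noteq> {}" using that by (auto simp: N_def)
    have m: "Max ?A \<in> ?A" using f ne by (rule Max_in)
    have "T \<omega> \<inter> {0<..Max ?A} = ?A"
      using m f by (auto intro: Max_ge)
    then show ?thesis using m by (intro bexI[of _ "Max ?A"]) (auto simp: N_def)
  qed
  have X_le: "X k \<omega> \<le> a \<longleftrightarrow> Suc k \<le> N a \<omega>" and X_in: "X k \<omega> \<in> T \<omega>"
    if \<omega>: "\<omega> \<in> space M" and H: "H k \<omega>" for k \<omega> a
  proof -
    let ?B = "{t \<in> T \<omega>. Suc k \<le> N t \<omega>}"
    obtain m :: nat where "Suc k \<le> N m \<omega>" using H by (auto simp: H_def)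
    then obtain b where b: "b \<in> ?B" using last[OF \<omega>, of m] by force
    have Bfin: "finite (?B \<inter> {..c})" for c
      using fin[OF \<omega>, of c] by (rule finite_subset[rotated]) auto
    have "\<exists>c\<in>?B. \<forall>t\<in>?B. c \<le> t"
    proof (intro bexI ballI)
      let ?c = "Min (?B \<inter> {..b})"
      have "?c \<in> ?B \<inter> {..b}" using Bfin b by (intro Min_in) auto
      then show "?c \<in> ?B" by blast
      fix t assume t: "t \<in> ?B"
      show "?c \<le> t"
      proof (cases "t \<le> b")
        case True
        then show ?thesis using t Bfin by (intro Min_le) auto
      next
        case False
        then show ?thesis using \<open>?c \<in> ?B \<inter> {..b}\<close> by auto
      qed
    qed
    then obtain c where c: "c \<in> ?B" "\<And>t. t \<in> ?B \<Longrightarrow> c \<le> t" by blast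
    have Xc: "X k \<omega> = c"
      unfolding X_def using H c by (auto intro!: cInf_eq_minimum)
    then show "X k \<omega> \<in> T \<omega>" using c by simp
    show "X k \<omega> \<le> a \<longleftrightarrow> Suc k \<le> N a \<omega>"
    proof
      assume "X k \<omega> \<le> a"
      then show "Suc k \<le> N a \<omega>" using Xc c N_mono[OF \<omega>, of c a] by auto
    next
      assume k: "Suc k \<le> N a \<omega>"
      then obtain d where "d \<in> T \<omega>" "d \<le> a" "N d \<omega> = N a \<omega>" using last[OF \<omega>, of a] by auto
      then show "X k \<omega> \<le> a" using Xc c(2)[of d] k by auto
    qed
  qed
  show thesis
  proof
    fix k
    show "X k \<in> borel_measurable M"
    proof (rule borel_measurableI_le)
      fix a
      have "{\<omega> \<in> space M. X k \<omega> \<le> a} =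
          {\<omega> \<in> space M. H k \<omega>} \<inter> {\<omega> \<in> space M. Suc k \<le> N a \<omega>} \<union>
          ((space M - {\<omega> \<in> space M. H k \<omega>}) \<inter> {\<omega> \<in> space M. 0 \<le> a})"
        using X_le by (auto simp: X_def split: if_splits)
      also have "\<dots> \<in> sets M" using H_meas[of k] by measurable
      finally show "{\<omega> \<in> space M. X k \<omega> \<le> a} \<in> sets M" .
    qed
  next
    fix \<omega> assume \<omega>: "\<omega> \<in> space M"
    have "\<exists>k. t = X k \<omega> \<and> 0 < X k \<omega>" if t: "t \<in> T \<omega>" for t
    proof -
      have t0: "0 < t" using t pos[OF \<omega>] by auto
      have f: "finite (T \<omega> \<inter> {0<..t})"
        using fin[OF \<omega>, of t] by (rule finite_subset[rotated]) auto
      then have "0 < N t \<omega>" using t t0 by (auto simp: N_def card_gt_0_iff)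
      then obtain k where k: "N t \<omega> = Suc k" using gr0_implies_Suc by blast
      obtain m :: nat where "t \<le> m" using real_arch_simple by blast
      then have H: "H k \<omega>" using k N_mono[OF \<omega>, of t m] by (auto simp: H_def)
      have le: "X k \<omega> \<le> t" using X_le[OF \<omega> H, of t] k by simp
      have "Suc k \<le> N (X k \<omega>) \<omega>" using X_le[OF \<omega> H, of "X k \<omega>"] by simp
      moreover have "N (X k \<omega>) \<omega> < N t \<omega>" if "X k \<omega> < t"
        unfolding N_def
      proof (rule psubset_card_mono[OF f])
        have "t \<in> T \<omega> \<inter> {0<..t}" "t \<notin> T \<omega> \<inter> {0<..X k \<omega>}" using t t0 that by auto
        moreover have "T \<omega> \<inter> {0<..X k \<omega>} \<subseteq> T \<omega> \<inter> {0<..t}" using that by auto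
        ultimately show "T \<omega> \<inter> {0<..X k \<omega>} \<subset> T \<omega> \<inter> {0<..t}" by blast
      qed
      ultimately have "X k \<omega> = t" using le k by fastforce
      then show ?thesis using t0 by auto
    qed
    moreover have "X k \<omega> \<in> T \<omega>" if "0 < X k \<omega>" for k
      using that X_in[OF \<omega>, of k] by (auto simp: X_def split: if_splits)
    ultimately show "T \<omega> = {X k \<omega> | k. 0 < X k \<omega>}" by auto
  qed
qed

text \<open>
  A list of pairs (target, index of the ring used), latest jump first, describes the jumps of a
  particle started at \<open>x\<close>; \<open>X e j\<close> are the ring times of \<open>e\<close>.
\<close>

context
  fixes G :: "'v pair_pre_digraph" and X :: "'v \<times> 'v \<Rightarrow> nat \<Rightarrow> 'w \<Rightarrow> real" and x :: 'v
begin

primrec jump_pos :: "('v \<times> nat) list \<Rightarrow> 'v" where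
  "jump_pos [] = x"
| "jump_pos (p # l) = fst p"

primrec jump_time :: "('v \<times> nat) list \<Rightarrow> 'w \<Rightarrow> real" where
  "jump_time [] \<omega> = 0"
| "jump_time (p # l) \<omega> = X (jump_pos l, fst p) (snd p) \<omega>"

primrec jump_ok :: "('v \<times> nat) list \<Rightarrow> 'w \<Rightarrow> bool" where
  "jump_ok [] \<omega> \<longleftrightarrow> True"
| "jump_ok (p # l) \<omega> \<longleftrightarrow> jump_ok l \<omega> \<and> (jump_pos l, fst p) \<in> parcs G \<and>
     jump_time l \<omega> < X (jump_pos l, fst p) (snd p) \<omega> \<and>
     (\<forall>w\<in>{w. (jump_pos l, w) \<in> parcs G}. \<forall>j. \<not> (jump_time l \<omega> < X (jump_pos l, w) j \<omega> \<and>
        X (jump_pos l, w) j \<omega> < X (jump_pos l, fst p) (snd p) \<omega>))"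

lemma jump_time_nonneg: "jump_ok l \<omega> \<Longrightarrow> 0 \<le> jump_time l \<omega>"
  by (induction l) auto

lemma particle_at_iff_jumps:
  assumes x: "x \<in> pverts G"
    and K: "\<And>e. e \<in> parcs G \<Longrightarrow> K e = {X e j \<omega> | j. 0 < X e j \<omega>}"
  shows "particle_at G K x t v \<longleftrightarrow>
    (\<exists>l. jump_ok l \<omega> \<and> jump_pos l = v \<and> jump_time l \<omega> \<le> t \<and>
       (\<forall>w\<in>{w. (v, w) \<in> parcs G}. \<forall>j. \<not> (jump_time l \<omega> < X (v, w) j \<omega> \<and> X (v, w) j \<omega> \<le> t)))"
    (is "_ \<longleftrightarrow> (\<exists>l. ?Q t v l)")
proof
  assume "particle_at G K x t v"
  then show "\<exists>l. ?Q t v l"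
  proof induction
    case start
    show ?case by (rule exI[of _ "[]"]) auto
  next
    case (stay s u t)
    then obtain l where l: "?Q s u l" by blast
    have "\<not> (jump_time l \<omega> < X (u, w) j \<omega> \<and> X (u, w) j \<omega> \<le> t)" if w: "(u, w) \<in> parcs G" for w j
    proof
      assume j: "jump_time l \<omega> < X (u, w) j \<omega> \<and> X (u, w) j \<omega> \<le> t"
      then have "X (u, w) j \<omega> \<in> K (u, w)"
        using K[OF w] jump_time_nonneg[of l \<omega>] l by fastforce
      moreover have "s < X (u, w) j \<omega>" using l w j by force
      ultimately show False using stay w j by fastforce
    qed
    then show ?case using l stay by (intro exI[of _ l]) auto
  next
    case (jump s u t w)
    then obtain l where l: "?Q s u l" by blast
    obtain i where i: "t = X (u, w) i \<omega>" using K[of "(u, w)"] jump by auto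
    have "\<not> (jump_time l \<omega> < X (u, w') j \<omega> \<and> X (u, w') j \<omega> < t)" if w: "(u, w') \<in> parcs G" for w' j
    proof
      assume j: "jump_time l \<omega> < X (u, w') j \<omega> \<and> X (u, w') j \<omega> < t"
      then have "X (u, w') j \<omega> \<in> K (u, w')"
        using K[OF w] jump_time_nonneg[of l \<omega>] l by fastforce
      moreover have "s < X (u, w') j \<omega>" using l w j by force
      ultimately show False using jump w j by fastforce
    qed
    then show ?case using l jump i by (intro exI[of _ "(w, i) # l"]) auto
  qed
next
  have at_jump: "jump_ok l \<omega> \<Longrightarrow> particle_at G K x (jump_time l \<omega>) (jump_pos l)" for l
  proof (induction l)
    case Nil
    then show ?case using x by (auto intro: particle_at.start)
  next
    case (Cons p l)
    then have *: "0 \<le> jump_time l \<omega>" using jump_time_nonneg by simp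
    have "X (jump_pos l, fst p) (snd p) \<omega> \<in> K (jump_pos l, fst p)"
      using Cons.prems * K[of "(jump_pos l, fst p)"] by fastforce
    then show ?case
      using Cons K
      by (auto intro!: particle_at.jump[of G K x "jump_time l \<omega>" "jump_pos l"])
  qed
  assume "\<exists>l. ?Q t v l"
  then obtain l where l: "?Q t v l" by blast
  then have "particle_at G K x (jump_time l \<omega>) v" "jump_time l \<omega> \<le> t" using at_jump[of l] by auto
  moreover have "\<forall>w. (v, w) \<in> parcs G \<longrightarrow> K (v, w) \<inter> {jump_time l \<omega><..t} = {}"
  proof (intro allI impI)
    fix w assume w: "(v, w) \<in> parcs G"
    show "K (v, w) \<inter> {jump_time l \<omega><..t} = {}" unfolding K[OF w] using l w by auto
  qed
  ultimately show "particle_at G K x t v" by (rule particle_at.stay)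
qed

end

text \<open>The event in \<open>occupation_prob\<close> is measurable, so its probability is not a junk value.\<close>

lemma (in prob_space) occupation_event_measurable:
  assumes G: "pair_bidirected_digraph G" "Digraph_Component.connected (with_proj G)"
    "locally_finite G"
    and R: "poisson_clocks (parcs G) R"
  shows "{\<omega> \<in> space M. crw_config G (\<lambda>e. R e \<omega>) t v = 1} \<in> events"
proof -
  interpret pair_bidirected_digraph G by fact
  have cV: "countable (pverts G)" using countable_pverts[OF G] .
  have "\<exists>X :: nat \<Rightarrow> 'a \<Rightarrow> real. (\<forall>k. X k \<in> borel_measurable M) \<and>
      (\<forall>\<omega>\<in>space M. R e \<omega> = {X k \<omega> | k. 0 < X k \<omega>})" if "e \<in> parcs G" for e
  proof -
    have "poisson_process 1 (R e)" using R that by (simp add: poisson_clocks_def)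
    then show ?thesis by (rule ring_times_measurable) blast
  qed
  then have "\<exists>X :: _ \<Rightarrow> nat \<Rightarrow> 'a \<Rightarrow> real. \<forall>e\<in>parcs G. (\<forall>k. X e k \<in> borel_measurable M) \<and>
      (\<forall>\<omega>\<in>space M. R e \<omega> = {X e k \<omega> | k. 0 < X e k \<omega>})"
    by (intro bchoice ballI)
  then obtain X0 :: "_ \<Rightarrow> nat \<Rightarrow> 'a \<Rightarrow> real" where "\<forall>e\<in>parcs G. (\<forall>k. X0 e k \<in> borel_measurable M) \<and>
      (\<forall>\<omega>\<in>space M. R e \<omega> = {X0 e k \<omega> | k. 0 < X0 e k \<omega>})" ..
  then have X0: "\<And>e k. e \<in> parcs G \<Longrightarrow> X0 e k \<in> borel_measurable M"
    "\<And>e \<omega>. e \<in> parcs G \<Longrightarrow> \<omega> \<in> space M \<Longrightarrow> R e \<omega> = {X0 e k \<omega> | k. 0 < X0 e k \<omega>}"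
    by simp_all
  define X where "X e = (if e \<in> parcs G then X0 e else (\<lambda>_ _. 0))" for e
  have X [measurable]: "X e k \<in> borel_measurable M" for e k
    using X0 by (cases "e \<in> parcs G") (auto simp: X_def)
  have XR: "R e \<omega> = {X e k \<omega> | k. 0 < X e k \<omega>}" if "e \<in> parcs G" "\<omega> \<in> space M" for e \<omega>
    using X0 that by (simp add: X_def)
  have nbrs: "countable {w. (u, w) \<in> parcs G}" for u
    by (rule countable_subset[OF _ cV]) (auto dest: in_arcsD2)
  have time [measurable]: "jump_time X x l \<in> borel_measurable M" for x l
    by (induction l) auto
  have ok [measurable]: "{\<omega> \<in> space M. jump_ok G X x l \<omega>} \<in> sets M" for x l
  proof (induction l)
    case (Cons p l)
    have *: "{\<omega> \<in> space M. \<forall>w\<in>{w. (jump_pos x l, w) \<in> parcs G}. \<forall>j.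
        \<not> (jump_time X x l \<omega> < X (jump_pos x l, w) j \<omega> \<and>
          X (jump_pos x l, w) j \<omega> < X (jump_pos x l, fst p) (snd p) \<omega>)} \<in> sets M"
      by (rule sets.sets_Collect_countable_All'[OF _ nbrs]) measurable
    show ?case
      unfolding jump_ok.simps
      by (intro sets.sets_Collect_conj sets.sets_Collect_const Cons *) measurable
  qed simp
  define Q where "Q x l \<omega> \<longleftrightarrow> jump_ok G X x l \<omega> \<and> jump_pos x l = v \<and> jump_time X x l \<omega> \<le> t \<and>
      (\<forall>w\<in>{w. (v, w) \<in> parcs G}. \<forall>j. \<not> (jump_time X x l \<omega> < X (v, w) j \<omega> \<and> X (v, w) j \<omega> \<le> t))"
    for x l \<omega>
  have Q: "{\<omega> \<in> space M. Q x l \<omega>} \<in> sets M" for x l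
  proof -
    have *: "{\<omega> \<in> space M. \<forall>w\<in>{w. (v, w) \<in> parcs G}. \<forall>j.
        \<not> (jump_time X x l \<omega> < X (v, w) j \<omega> \<and> X (v, w) j \<omega> \<le> t)} \<in> sets M"
      by (rule sets.sets_Collect_countable_All'[OF _ nbrs]) measurable
    show ?thesis
      unfolding Q_def
      by (intro sets.sets_Collect_conj sets.sets_Collect_const ok *) measurable
  qed
  have set_l: "l \<in> lists (pverts G \<times> UNIV)" if "jump_ok G X x l \<omega>" for x l \<omega>
    using that by (induction l) (auto dest: in_arcsD2)
  have "{\<omega> \<in> space M. crw_config G (\<lambda>e. R e \<omega>) t v = 1} =
      (\<Union>x\<in>pverts G. \<Union>l\<in>lists (pverts G \<times> UNIV). {\<omega> \<in> space M. Q x l \<omega>})"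
  proof (intro set_eqI iffI)
    fix \<omega> assume "\<omega> \<in> {\<omega> \<in> space M. crw_config G (\<lambda>e. R e \<omega>) t v = 1}"
    then obtain x where x: "\<omega> \<in> space M" "x \<in> pverts G" "particle_at G (\<lambda>e. R e \<omega>) x t v"
      by (auto simp: crw_config_def split: if_splits)
    then obtain l where "Q x l \<omega>"
      using particle_at_iff_jumps[of x G "\<lambda>e. R e \<omega>" X \<omega> t v] XR unfolding Q_def by blast
    moreover from this have "l \<in> lists (pverts G \<times> UNIV)" using set_l unfolding Q_def by blast
    ultimately show "\<omega> \<in> (\<Union>x\<in>pverts G. \<Union>l\<in>lists (pverts G \<times> UNIV). {\<omega> \<in> space M. Q x l \<omega>})"
      using x by blast
  next
    fix \<omega> assume "\<omega> \<in> (\<Union>x\<in>pverts G. \<Union>l\<in>lists (pverts G \<times> UNIV). {\<omega> \<in> space M. Q x l \<omega>})"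
    then obtain x l where x: "\<omega> \<in> space M" "x \<in> pverts G" "Q x l \<omega>" by blast
    then have "particle_at G (\<lambda>e. R e \<omega>) x t v"
      using particle_at_iff_jumps[of x G "\<lambda>e. R e \<omega>" X \<omega> t v] XR unfolding Q_def by blast
    then show "\<omega> \<in> {\<omega> \<in> space M. crw_config G (\<lambda>e. R e \<omega>) t v = 1}"
      using x by (auto simp: crw_config_def)
  qed
  also have "\<dots> \<in> events"
    using cV Q by (intro sets.countable_UN' countable_lists countable_SIGMA) auto
  finally show ?thesis .
qed

end

theory Submission
  imports Defs
begin

text \<open>
  Reverse time: for \<open>0 \<le> s \<le> t\<close> let \<open>A\<^sub>s\<close> be the set of vertices from which a particle present at
  time \<open>t - s\<close> reaches \<open>v\<close> at time \<open>t\<close>; then \<open>v\<close> is occupied at time \<open>t\<close> iff \<open>A\<^sub>t\<close> is nonempty. A ring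
  of \<open>(u, w)\<close> puts \<open>u\<close> into the set if \<open>w\<close> belongs to it and takes \<open>u\<close> out otherwise (the voter
  model), so the size of \<open>A\<^sub>s\<close> goes up and down by one at equal rates, and because the graph is
  infinite and connected these rates are at least 1 while the set is finite and nonempty. With
  \<open>f n = n (2 N - n)\<close>, the value \<open>f (card A\<^sub>s)\<close> has drift at most \<open>-1\<close> until the size is \<open>0\<close> or \<open>N\<close>.
  As \<open>f 1 \<le> 2 N\<close> and \<open>f N = N\<^sup>2\<close>, the probability that \<open>A\<^sub>t\<close> is nonempty is at most
  \<open>2 N / t + 2 / N\<close>.

  Two approximations make this a statement about finite chains. Only particles that stay in a
  finite set \<open>W\<close> are followed, which can only lower the rate of up-steps, and \<open>W\<close> grows to the whole
  graph at the end. Time is cut into \<open>m\<close> intervals; those with two or more rings on the finitely many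
  arcs leaving \<open>W\<close> have total probability \<open>O(1/m)\<close>.
\<close>

section \<open>Particles confined to a set\<close>

text \<open>The start time \<open>r\<close> is arbitrary, so that walks can be cut and restarted.
  Silence is required on all arcs of \<open>E\<close>, those leaving \<open>W\<close> included:
  confinement discards walks but does not alter how they move.\<close>

inductive confined_at ::
  "('v \<times> 'v) set \<Rightarrow> 'v set \<Rightarrow> ('v \<times> 'v \<Rightarrow> real set) \<Rightarrow> real \<Rightarrow> 'v \<Rightarrow> real \<Rightarrow> 'v \<Rightarrow> bool"
  for E W K r x where
  start: "x \<in> W \<Longrightarrow> confined_at E W K r x r x"
| stay: "confined_at E W K r x s u \<Longrightarrow> s \<le> t \<Longrightarrow>
    \<forall>w. (u, w) \<in> E \<longrightarrow> K (u, w) \<inter> {s<..t} = {} \<Longrightarrow> confined_at E W K r x t u"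
| jump: "confined_at E W K r x s u \<Longrightarrow> s < t \<Longrightarrow> (u, w) \<in> E \<Longrightarrow> t \<in> K (u, w) \<Longrightarrow> w \<in> W \<Longrightarrow>
    \<forall>w'. (u, w') \<in> E \<longrightarrow> K (u, w') \<inter> {s<..<t} = {} \<Longrightarrow> confined_at E W K r x t w"

lemma confined_atD: "confined_at E W K r x t u \<Longrightarrow> x \<in> W \<and> u \<in> W \<and> r \<le> t"
  by (induction rule: confined_at.induct) auto

text \<open>During the last rule the walk rests at \<open>u\<close>, so a cut falling there is made
  at \<open>u\<close>; an earlier cut is left to the induction.\<close>

lemma confined_at_split:
  assumes "confined_at E W K r x t v" "r \<le> s" "s \<le> t"
  shows "\<exists>y. confined_at E W K r x s y \<and> confined_at E W K s y t v"
  using assms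
proof (induction arbitrary: s rule: confined_at.induct)
  case start
  then have "s = r" by simp
  with start show ?case by (auto intro: confined_at.start)
next
  case (stay q u t)
  show ?case
  proof (cases "s \<le> q")
    case True
    with stay obtain y where "confined_at E W K r x s y" "confined_at E W K s y q u" by blast
    with stay show ?thesis by (blast intro: confined_at.stay)
  next
    case False
    then have "confined_at E W K r x s u"
      using stay.prems stay.hyps by (intro confined_at.stay[OF stay.hyps(1)]) force+
    moreover have "confined_at E W K s u t u"
      using False stay.prems stay.hyps confined_atD[OF stay.hyps(1)]
      by (intro confined_at.stay[OF confined_at.start]) force+
    ultimately show ?thesis by blast
  qed
next
  case (jump q u t w)
  consider "s \<le> q" | "q < s" "s < t" | "s = t" using jump.prems by linarith
  then show ?case
  proof cases
    case 1
    with jump obtain y where "confined_at E W K r x s y" "confined_at E W K s y q u" by blast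
    with jump show ?thesis by (blast intro: confined_at.jump)
  next
    case 2
    then have "confined_at E W K r x s u"
      using jump.prems jump.hyps by (intro confined_at.stay[OF jump.hyps(1)]) force+
    moreover have "confined_at E W K s u t w"
      using 2 jump.hyps confined_atD[OF jump.hyps(1)]
      by (intro confined_at.jump[OF confined_at.start, of u]) force+
    ultimately show ?thesis by blast
  next
    \<comment> \<open>A cut exactly at the jump time assigns the jump to the left piece, in line
      with intervals that are open on the left and closed on the right.\<close>
    case 3
    have "confined_at E W K r x t w" by (rule confined_at.jump[OF jump.hyps(1-6)])
    then show ?thesis using 3 jump.hyps by (auto intro: confined_at.start)
  qed
qed

text \<open>The window ends at a fixed \<open>b\<close>, so that the hypothesis stays the same while
  \<open>t\<close> varies in the induction. Arcs starting in \<open>W\<close> suffice because the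
  walk never leaves \<open>W\<close>.\<close>

lemma confined_at_no_ring:
  assumes "confined_at E W K r x t v" "\<And>e. e \<in> E \<Longrightarrow> fst e \<in> W \<Longrightarrow> K e \<inter> {r<..b} = {}" "t \<le> b"
  shows "v = x"
  using assms
proof (induction rule: confined_at.induct)
  case (jump s u t w)
  then have "r \<le> s" "u \<in> W" using confined_atD[OF jump.hyps(1)] by auto
  then have "t \<in> K (u, w) \<inter> {r<..b}" using jump.hyps jump.prems(2) by simp
  moreover have "K (u, w) \<inter> {r<..b} = {}" using jump.prems(1)[OF jump.hyps(3)] \<open>u \<in> W\<close> by simp
  ultimately show ?case by blast
qed auto

text \<open>With one ring in the window the walk is a deterministic function of its start; the
  formula is an invariant along the whole walk, before and after \<tau>.\<close>

lemma confined_at_one_ring: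
  assumes "confined_at E W K r x t v" "(a, c) \<in> E"
    and "\<And>e. e \<in> E \<Longrightarrow> fst e \<in> W \<Longrightarrow> K e \<inter> {r<..b} = (if e = (a, c) then {\<tau>} else {})"
    and "t \<le> b"
  shows "v = (if x = a \<and> \<tau> \<le> t then c else x)"
  using assms
proof (induction rule: confined_at.induct)
  case start
  have "\<not> \<tau> \<le> r" if "x = a"
  proof -
    have "\<tau> \<in> K (a, c) \<inter> {r<..b}" using start that by auto
    then show ?thesis by simp
  qed
  then show ?case by auto
next
  case (stay s u t)
  then have IH: "u = (if x = a \<and> \<tau> \<le> s then c else x)" by simp
  have rs: "r \<le> s" "u \<in> W" using confined_atD[OF stay.hyps(1)] by auto
  \<comment> \<open>A walk still waiting at \<open>a\<close> at time \<open>s\<close> cannot rest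
    past \<tau>, as that ring would break the silence demanded by the rule.\<close>
  have "\<not> \<tau> \<le> t" if "x = a" "\<not> \<tau> \<le> s"
  proof
    assume "\<tau> \<le> t"
    have "\<tau> \<in> K (a, c) \<inter> {r<..b}" using stay.prems IH that rs by auto
    then have "\<tau> \<in> K (u, c) \<inter> {s<..t}" using IH that \<open>\<tau> \<le> t\<close> by simp
    moreover have "(u, c) \<in> E" using IH that stay.prems by simp
    ultimately show False using stay.hyps by blast
  qed
  then show ?case using IH stay.hyps(2) by auto
next
  case (jump s u t w)
  then have IH: "u = (if x = a \<and> \<tau> \<le> s then c else x)" by simp
  have rs: "r \<le> s" "u \<in> W" using confined_atD[OF jump.hyps(1)] by auto
  have "t \<in> K (u, w) \<inter> {r<..b}" using jump.hyps jump.prems(3) rs by simp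
  \<comment> \<open>The ring that is used must be the only one. Since \<open>s < t = \<tau>\<close>,
    the walk has not moved before, so \<open>u\<close> is still the start \<open>x\<close>.\<close>
  then have "(u, w) = (a, c)" "t = \<tau>"
    using jump.prems(2)[OF jump.hyps(3)] rs by (auto split: if_splits)
  then show ?case using IH jump.hyps by auto
qed

text \<open>The chain is frozen once its size reaches \<open>0\<close> or the cap \<open>N\<close>.\<close>

section \<open>The dual chain\<close>

definition dual_step :: "nat \<Rightarrow> ('v \<times> 'v) option \<Rightarrow> 'v set \<Rightarrow> 'v set" where
  "dual_step N j A = (if A = {} \<or> N \<le> card A then A
     else case j of None \<Rightarrow> A | Some (u, w) \<Rightarrow> if w \<in> A then insert u A else A - {u})"

lemma dual_step_frozen: "A = {} \<or> N \<le> card A \<Longrightarrow> dual_step N j A = A"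
  unfolding dual_step_def by argo

lemma dual_step_active:
  assumes "A \<noteq> {}" "card A < N"
  shows "dual_step N None A = A"
    and "dual_step N (Some (u, w)) A = (if w \<in> A then insert u A else A - {u})"
  using assms by (auto simp: dual_step_def)

section \<open>The mark of a time interval, and comparison of walks with the chain of marks\<close>

definition sole_ring :: "'e set \<Rightarrow> ('e \<Rightarrow> nat) \<Rightarrow> 'e \<Rightarrow> bool" where
  "sole_ring F c e \<longleftrightarrow> e \<in> F \<and> (\<forall>e'\<in>F. c e' = (if e' = e then 1 else 0))"

text \<open>\<open>None\<close> stands both for no ring and for several rings; the latter is excluded with high probability.\<close>

definition ring_mark :: "'e set \<Rightarrow> ('e \<Rightarrow> nat) \<Rightarrow> 'e option" where
  "ring_mark F c = (if \<exists>e. sole_ring F c e then Some (SOME e. sole_ring F c e) else None)"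

lemma sole_ring_unique: "sole_ring F c e \<Longrightarrow> sole_ring F c e' \<Longrightarrow> e' = e"
  unfolding sole_ring_def by (metis zero_neq_one)

lemma ring_mark_eq_Some: "ring_mark F c = Some e \<longleftrightarrow> sole_ring F c e"
proof (cases "\<exists>e. sole_ring F c e")
  case True
  define e' where "e' = (SOME e. sole_ring F c e)"
  have e': "sole_ring F c e'" unfolding e'_def using True by (rule someI_ex)
  have "ring_mark F c = Some e'" using True by (simp only: ring_mark_def e'_def if_True)
  moreover have "sole_ring F c e \<longleftrightarrow> e' = e" using e' sole_ring_unique[of F c e e'] by blast
  ultimately show ?thesis by simp
next
  case False
  then show ?thesis by (simp add: ring_mark_def)
qed

text \<open>With at most one ring, the walk from \<open>x\<close> ends at a determined vertex
  \<open>y\<close>, and \<open>dual_step\<close> pulls \<open>A\<close> back along this map: only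
  the tail \<open>u\<close> of the ringing arc is moved, so only its membership is reset, according
  to whether \<open>w\<close> is in \<open>A\<close>.\<close>

lemma confined_at_dual_step:
  assumes "confined_at E W K r x s y"
    and "\<And>e. e \<in> E \<Longrightarrow> finite (K e \<inter> {r<..s})"
    and F: "F = {e \<in> E. fst e \<in> W}"
    and c: "c = (\<lambda>e. card (K e \<inter> {r<..s}))"
    and "(\<forall>e\<in>F. c e = 0) \<or> (\<exists>e. sole_ring F c e)"
    and "y \<in> A" "card A < N"
  shows "x \<in> dual_step N (ring_mark F c) A"
  using assms(5)
proof
  assume z: "\<forall>e\<in>F. c e = 0"
  have "y = x"
  proof (rule confined_at_no_ring[OF assms(1) _ order.refl])
    fix e assume "e \<in> E" "fst e \<in> W"
    moreover from this have "card (K e \<inter> {r<..s}) = 0" using z F c by blast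
    ultimately show "K e \<inter> {r<..s} = {}" using assms(2) by simp
  qed
  moreover have "ring_mark F c = None"
    using z by (auto simp: ring_mark_def sole_ring_def split: if_splits)
  ultimately show ?thesis using assms dual_step_active(1)[of A N] by auto
next
  assume "\<exists>e. sole_ring F c e"
  then obtain u w where e: "sole_ring F c (u, w)" by auto
  then have uw: "(u, w) \<in> E" "card (K (u, w) \<inter> {r<..s}) = 1"
    by (auto simp: sole_ring_def F c)
  then obtain \<tau> where \<tau>: "K (u, w) \<inter> {r<..s} = {\<tau>}" by (auto simp: card_1_singleton_iff)
  have *: "K e \<inter> {r<..s} = (if e = (u, w) then {\<tau>} else {})" if "e \<in> E" "fst e \<in> W" for e
  proof (cases "e = (u, w)")
    case False
    have "e \<in> F" using that F by simp
    then have "card (K e \<inter> {r<..s}) = 0" using e False by (auto simp: sole_ring_def c)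
    then show ?thesis using assms(2)[OF that(1)] False by simp
  qed (use \<tau> in simp)
  have "y = (if x = u \<and> \<tau> \<le> s then w else x)"
    by (rule confined_at_one_ring[OF assms(1) uw(1) * order.refl])
  moreover have "\<tau> \<le> s" using \<tau> by auto
  moreover have "dual_step N (ring_mark F c) A = (if w \<in> A then insert u A else A - {u})"
  proof -
    have "ring_mark F c = Some (u, w)" using e by (simp add: ring_mark_eq_Some)
    moreover have "A \<noteq> {}" using \<open>y \<in> A\<close> by blast
    ultimately show ?thesis using \<open>card A < N\<close> by (simp add: dual_step_active)
  qed
  ultimately show ?thesis using \<open>y \<in> A\<close> by (auto split: if_splits)
qed

fun iter_marks :: "('j \<Rightarrow> 's \<Rightarrow> 's) \<Rightarrow> 's \<Rightarrow> (nat \<Rightarrow> 'j) \<Rightarrow> nat \<Rightarrow> 's" where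
  "iter_marks f a j 0 = a"
| "iter_marks f a j (Suc k) = f (j k) (iter_marks f a j k)"

lemma dual_chain_nonempty:
  assumes walk: "confined_at E W K (\<tau> 0) x (\<tau> m) v"
    and "mono \<tau>"
    and fin: "\<And>e s. e \<in> E \<Longrightarrow> finite (K e \<inter> {..s})"
    and F: "F = {e \<in> E. fst e \<in> W}"
    and c: "c = (\<lambda>i e. card (K e \<inter> {\<tau> i<..\<tau> (Suc i)}))"
    and good: "\<And>i. i < m \<Longrightarrow> (\<forall>e\<in>F. c i e = 0) \<or> (\<exists>e. sole_ring F (c i) e)"
    and "0 < N"
  shows "iter_marks (dual_step N) {v} (\<lambda>k. ring_mark F (c (m - Suc k))) m \<noteq> {}"
proof -
  let ?S = "iter_marks (dual_step N) {v} (\<lambda>k. ring_mark F (c (m - Suc k)))"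
  have fin': "finite (K e \<inter> {r<..s})" if "e \<in> E" for e r s
    by (rule finite_subset[OF _ fin[OF that, of s]]) auto
  \<comment> \<open>Invariant over the last \<open>k\<close> intervals: all possible starting points
    lie in the dual set. The alternative covers a chain frozen at the cap, which no longer tracks
    them but is nonempty as \<open>0 < N\<close>.\<close>
  have "confined_at E W K (\<tau> (m - k)) y (\<tau> m) v \<Longrightarrow> y \<in> ?S k \<or> N \<le> card (?S k)"
    if "k \<le> m" for k y
    using that
  proof (induction k arbitrary: y)
    case 0
    then have "v = y"
    proof -
      have "confined_at E W K (\<tau> m) y (\<tau> m) v" using 0 by simp
      then show ?thesis by (rule confined_at_no_ring[where b = "\<tau> m"]) auto
    qed
    then show ?case by simp
  next
    case (Suc k)
    define i where "i = m - Suc k"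
    have i: "m - k = Suc i" "i < m" using Suc.prems by (auto simp: i_def)
    obtain z where z: "confined_at E W K (\<tau> i) y (\<tau> (Suc i)) z" "confined_at E W K (\<tau> (Suc i)) z (\<tau> m) v"
      using confined_at_split[OF Suc.prems(1), of "\<tau> (Suc i)"] i Suc.prems \<open>mono \<tau>\<close>
      by (auto simp: i_def mono_def)
    have IH: "z \<in> ?S k \<or> N \<le> card (?S k)" using Suc.IH[of z] z i Suc.prems by auto
    show ?case
    proof (cases "N \<le> card (?S k)")
      case True
      then have "dual_step N j (?S k) = ?S k" for j by (rule dual_step_frozen[OF disjI2])
      then show ?thesis using True by simp
    next
      case False
      have "y \<in> dual_step N (ring_mark F (c i)) (?S k)"
        by (rule confined_at_dual_step[OF z(1) _ F _ good[OF i(2)]])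
          (use IH False in \<open>simp_all add: c fin'\<close>)
      then show ?thesis by (simp add: i_def)
    qed
  qed
  from this[of m x] walk have "x \<in> ?S m \<or> N \<le> card (?S m)" by simp
  then show ?thesis using \<open>0 < N\<close> by auto
qed

section \<open>A concave function of the size that decreases in mean\<close>

definition potential :: "nat \<Rightarrow> 'v set \<Rightarrow> real" where
  "potential N A = real (card A) * (2 * real N - real (card A))"

text \<open>An arc of \<open>U\<close> adds a vertex and changes the potential by
  \<open>g - 1\<close>; an arc of \<open>D\<close> removes one and changes it by
  \<open>- g - 1\<close>; other arcs change nothing. Reversal injects \<open>U\<close> into
  \<open>D\<close>, and \<open>(a, b)\<close> lies in \<open>D\<close>, so the sum
  \<open>- (card D - card U) * g - (card U + card D)\<close> is at most -1.\<close>

lemma potential_drift: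
  assumes E: "\<And>u w. (u, w) \<in> E \<Longrightarrow> (w, u) \<in> E"
    and F: "F = {e \<in> E. fst e \<in> W}" "finite F"
    and A: "A \<subseteq> W" "finite A" "A \<noteq> {}" "card A < N"
    and bd: "(a, b) \<in> E" "a \<in> A" "b \<notin> A"
  shows "(\<Sum>e\<in>F. potential N (dual_step N (Some e) A) - potential N A) \<le> -1"
proof -
  define U where "U = {e \<in> F. fst e \<notin> A \<and> snd e \<in> A}"
  define D where "D = {e \<in> F. fst e \<in> A \<and> snd e \<notin> A}"
  define g where "g = 2 * real N - 2 * real (card A)"
  have fin: "finite U" "finite D" using F(2) by (simp_all add: U_def D_def)
  have n0: "card A > 0" using A by (simp add: card_gt_0_iff)
  have "potential N (dual_step N (Some e) A) - potential N A =
      (if e \<in> U then g - 1 else 0) + (if e \<in> D then - g - 1 else 0)" if "e \<in> F" for e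
  proof (cases e)
    case (Pair u w)
    show ?thesis
      using that A n0 unfolding Pair dual_step_active(2)[OF A(3,4)]
      by (cases "u \<in> A"; cases "w \<in> A")
        (auto simp: U_def D_def g_def potential_def insert_absorb of_nat_diff algebra_simps)
  qed
  then have "(\<Sum>e\<in>F. potential N (dual_step N (Some e) A) - potential N A) =
      (\<Sum>e\<in>F. if e \<in> U then g - 1 else 0) + (\<Sum>e\<in>F. if e \<in> D then - g - 1 else 0)"
    by (simp add: sum.distrib)
  also have "\<dots> = real (card U) * (g - 1) + real (card D) * (- g - 1)"
  proof -
    have "F \<inter> {e. e \<in> U} = U" "F \<inter> {e. e \<in> D} = D" by (auto simp: U_def D_def)
    then show ?thesis using F(2) by (simp add: sum.If_cases)
  qed
  finally have eq: "(\<Sum>e\<in>F. potential N (dual_step N (Some e) A) - potential N A) =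
      real (card U) * (g - 1) + real (card D) * (- g - 1)" .
  \<comment> \<open>Arcs of \<open>U\<close> have both ends in \<open>W\<close>, so their reversals also belong to \<open>F\<close>.\<close>
  have "card U \<le> card D"
  proof (rule card_inj_on_le[of prod.swap])
    show "prod.swap ` U \<subseteq> D" using E A F by (auto simp: U_def D_def)
  qed (use fin in auto)
  moreover have "card D > 0"
    using fin bd A F by (auto simp: card_gt_0_iff D_def)
  moreover have "g \<ge> 0" using A by (simp add: g_def)
  ultimately have "(real (card D) - real (card U)) * g \<ge> 0" "real (card D) \<ge> 1" by auto
  then show ?thesis unfolding eq by (simp add: algebra_simps)
qed

section \<open>Chains driven by independent marks\<close>

context prob_space
begin

text \<open>All state spaces below are finite, so this formula does the work of conditional
  expectations.\<close>

lemma expectation_finite_pair: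
  fixes \<psi> :: "'s \<Rightarrow> 't \<Rightarrow> real"
  assumes fin: "finite S" "finite T"
    and XY: "X \<in> measurable M (count_space S)" "Y \<in> measurable M (count_space T)"
  shows "expectation (\<lambda>\<omega>. \<psi> (X \<omega>) (Y \<omega>)) =
    (\<Sum>s\<in>S. \<Sum>t\<in>T. \<psi> s t * prob {\<omega> \<in> space M. X \<omega> = s \<and> Y \<omega> = t})"
proof -
  have ev: "{\<omega> \<in> space M. X \<omega> = s \<and> Y \<omega> = t} \<in> events" if "s \<in> S" "t \<in> T" for s t
  proof -
    have "X -` {s} \<inter> space M \<in> events" "Y -` {t} \<inter> space M \<in> events"
      using XY that by (auto intro: measurable_sets)
    then have "(X -` {s} \<inter> space M) \<inter> (Y -` {t} \<inter> space M) \<in> events" by blast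
    also have "(X -` {s} \<inter> space M) \<inter> (Y -` {t} \<inter> space M) = {\<omega> \<in> space M. X \<omega> = s \<and> Y \<omega> = t}"
      by auto
    finally show ?thesis .
  qed
  have "\<psi> (X \<omega>) (Y \<omega>) =
      (\<Sum>s\<in>S. \<Sum>t\<in>T. \<psi> s t * indicat_real {\<omega> \<in> space M. X \<omega> = s \<and> Y \<omega> = t} \<omega>)"
    if \<omega>: "\<omega> \<in> space M" for \<omega>
  proof -
    have in_ST: "X \<omega> \<in> S" "Y \<omega> \<in> T" using XY \<omega> by (auto dest: measurable_space)
    have "(\<Sum>s\<in>S. \<Sum>t\<in>T. \<psi> s t * indicat_real {\<omega> \<in> space M. X \<omega> = s \<and> Y \<omega> = t} \<omega>)
        = (\<Sum>s\<in>S. if s = X \<omega> then \<Sum>t\<in>T. if t = Y \<omega> then \<psi> s t else 0 else 0)"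
      using \<omega> by (intro sum.cong refl) (auto simp: indicator_def intro!: sum.cong)
    then show ?thesis using in_ST fin by simp
  qed
  then have "expectation (\<lambda>\<omega>. \<psi> (X \<omega>) (Y \<omega>)) = expectation (\<lambda>\<omega>.
      \<Sum>s\<in>S. \<Sum>t\<in>T. \<psi> s t * indicat_real {\<omega> \<in> space M. X \<omega> = s \<and> Y \<omega> = t} \<omega>)"
    by (rule Bochner_Integration.integral_cong[OF refl])
  also have "\<dots> = (\<Sum>s\<in>S. \<Sum>t\<in>T. \<psi> s t * prob {\<omega> \<in> space M. X \<omega> = s \<and> Y \<omega> = t})"
    using ev by (subst Bochner_Integration.integral_sum; simp add: emeasure_eq_measure)+
  finally show ?thesis .
qed

lemma iter_marks_cong:
  "(\<And>i. i < k \<Longrightarrow> j i = j' i) \<Longrightarrow> iter_marks f a j k = iter_marks f a j' k"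
  by (induction k) auto

lemma iter_marks_closed:
  assumes "a \<in> S" "\<And>i. i < k \<Longrightarrow> j i \<in> T" "\<And>i s. i \<in> T \<Longrightarrow> s \<in> S \<Longrightarrow> f i s \<in> S"
  shows "iter_marks f a j k \<in> S"
  using assms(2) by (induction k) (auto intro: assms)

text \<open>Markov property in integrated form: the state after \<open>k\<close> steps is a function
  of the marks before \<open>k\<close> and hence independent of mark \<open>k\<close>, which may be
  averaged out first.\<close>

lemma expectation_iter_marks_Suc:
  fixes \<phi> :: "'s \<Rightarrow> real"
  assumes indep: "indep_vars (\<lambda>_. count_space T) J {..<m}"
    and fin: "finite S" "finite T"
    and S: "a \<in> S" "\<And>i s. i \<in> T \<Longrightarrow> s \<in> S \<Longrightarrow> f i s \<in> S"
    and k: "k < m"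
  shows "expectation (\<lambda>\<omega>. \<phi> (iter_marks f a (\<lambda>i. J i \<omega>) (Suc k))) =
    expectation (\<lambda>\<omega>. \<Sum>j\<in>T. prob {\<omega> \<in> space M. J k \<omega> = j} *
      \<phi> (f j (iter_marks f a (\<lambda>i. J i \<omega>) k)))"
    and "(\<lambda>\<omega>. iter_marks f a (\<lambda>i. J i \<omega>) k) \<in> measurable M (count_space S)"
proof -
  define X where "X \<omega> = iter_marks f a (\<lambda>i. J i \<omega>) k" for \<omega>
  have PiM: "PiM I (\<lambda>_. count_space T) = count_space (PiE I (\<lambda>_. T))" if "finite I" for I :: "nat set"
    using that fin by (intro count_space_PiM_finite) (auto intro: countable_finite)
  have rJ: "J i \<in> measurable M (count_space T)" if "i < m" for i
    using indep that by (auto simp: indep_vars_def2)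
  have JT: "J i \<omega> \<in> T" if "i < m" "\<omega> \<in> space M" for i \<omega>
    using measurable_space[OF rJ[OF that(1)] that(2)] by simp
  have past: "(\<lambda>\<omega>. restrict (\<lambda>i. J i \<omega>) {..<k}) \<in> measurable M (count_space (PiE {..<k} (\<lambda>_. T)))"
    using k by (subst PiM[symmetric]) (auto intro!: measurable_restrict rJ)
  have step: "iter_marks f a h k \<in> S" if "h \<in> PiE {..<k} (\<lambda>_. T)" for h
    using that by (intro iter_marks_closed[where T = T] S) (auto simp: PiE_mem)
  have X_eq: "X = (\<lambda>h. iter_marks f a h k) \<circ> (\<lambda>\<omega>. restrict (\<lambda>i. J i \<omega>) {..<k})"
    by (auto simp: X_def fun_eq_iff intro!: iter_marks_cong)
  have rX: "X \<in> measurable M (count_space S)"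
    unfolding X_eq by (rule measurable_comp[OF past]) (use step in simp)
  note rv = rX rJ[OF k]
  show "(\<lambda>\<omega>. iter_marks f a (\<lambda>i. J i \<omega>) k) \<in> measurable M (count_space S)"
    using rv(1) by (simp add: X_def[abs_def])
  have pr: "prob {\<omega> \<in> space M. X \<omega> = s \<and> J k \<omega> = t} =
      prob {\<omega> \<in> space M. J k \<omega> = t} * prob {\<omega> \<in> space M. X \<omega> = s}" if "s \<in> S" "t \<in> T" for s t
  proof -
    let ?P = "\<lambda>\<omega>. restrict (\<lambda>i. J i \<omega>) {..<k}" and ?N = "\<lambda>\<omega>. restrict (\<lambda>i. J i \<omega>) {k}"
    let ?A = "{h \<in> PiE {..<k} (\<lambda>_. T). iter_marks f a h k = s}"
    let ?B = "{h \<in> PiE {k} (\<lambda>_. T). h k = t}"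
    have "indep_var (PiM {..<k} (\<lambda>_. count_space T)) ?P (PiM {k} (\<lambda>_. count_space T)) ?N"
      by (rule indep_var_restrict[OF indep]) (use k in auto)
    then have "prob ((\<lambda>x. (?P x, ?N x)) -` (?A \<times> ?B) \<inter> space M) =
        prob (?P -` ?A \<inter> space M) * prob (?N -` ?B \<inter> space M)"
      by (rule indep_varD) (auto simp: PiM)
    moreover have "?P -` ?A \<inter> space M = {\<omega> \<in> space M. X \<omega> = s}"
      using JT k by (auto simp: X_eq)
    moreover have "?N -` ?B \<inter> space M = {\<omega> \<in> space M. J k \<omega> = t}"
      using JT k by auto
    moreover have "(\<lambda>x. (?P x, ?N x)) -` (?A \<times> ?B) \<inter> space M = {\<omega> \<in> space M. X \<omega> = s \<and> J k \<omega> = t}"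
      using JT k by (auto simp: X_eq)
    ultimately show ?thesis by simp
  qed
  \<comment> \<open>A dummy second variable lets the formula for pairs serve for functions of
    \<open>X\<close> alone.\<close>
  have unit: "(\<lambda>_. ()) \<in> measurable M (count_space UNIV)" by simp
  have "expectation (\<lambda>\<omega>. \<phi> (f (J k \<omega>) (X \<omega>))) =
      (\<Sum>s\<in>S. \<Sum>t\<in>T. \<phi> (f t s) * prob {\<omega> \<in> space M. X \<omega> = s \<and> J k \<omega> = t})"
    by (rule expectation_finite_pair[OF fin rv])
  also have "\<dots> = (\<Sum>s\<in>S. (\<Sum>t\<in>T. prob {\<omega> \<in> space M. J k \<omega> = t} * \<phi> (f t s)) * prob {\<omega> \<in> space M. X \<omega> = s})"
    by (simp add: pr sum_distrib_left sum_distrib_right mult_ac)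
  also have "\<dots> = expectation (\<lambda>\<omega>. \<Sum>t\<in>T. prob {\<omega> \<in> space M. J k \<omega> = t} * \<phi> (f t (X \<omega>)))"
    using expectation_finite_pair[OF fin(1) _ rv(1) unit,
      of "\<lambda>s _. \<Sum>t\<in>T. prob {\<omega> \<in> space M. J k \<omega> = t} * \<phi> (f t s)"] by simp
  finally show "expectation (\<lambda>\<omega>. \<phi> (iter_marks f a (\<lambda>i. J i \<omega>) (Suc k))) =
    expectation (\<lambda>\<omega>. \<Sum>j\<in>T. prob {\<omega> \<in> space M. J k \<omega> = j} *
      \<phi> (f j (iter_marks f a (\<lambda>i. J i \<omega>) k)))"
    by (simp add: X_def)
qed

text \<open>Two independences are combined: whole counting paths are independent over arcs, and the
  increments of one path over time. The product formula is split first over arcs, then over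
  intervals.\<close>

lemma indep_poisson_increments:
  assumes clocks: "poisson_clocks A R" and F: "F \<subseteq> A" "finite F"
    and \<tau>: "mono \<tau>" "0 \<le> \<tau> (0::nat)"
  shows "indep_vars (\<lambda>_. count_space UNIV)
    (\<lambda>p \<omega>. card (R (snd p) \<omega> \<inter> {\<tau> (fst p)<..\<tau> (Suc (fst p))})) ({..<m} \<times> F)"
proof (cases "m = 0 \<or> F = {}")
  case True
  then show ?thesis by (auto simp: indep_vars_def indep_sets_def)
next
  case False
  define C where "C p \<omega> = card (R (snd p) \<omega> \<inter> {\<tau> (fst p)<..\<tau> (Suc (fst p))})" for p \<omega>
  define Q where "Q = Pi\<^sub>M {0::real..} (\<lambda>_. count_space (UNIV :: nat set))"
  have pos: "0 \<le> \<tau> i" for i using \<tau> monoD[OF \<tau>(1), of 0 i] by simp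
  have ind_e: "indep_vars (\<lambda>_. count_space UNIV) (\<lambda>i. C (i, e)) UNIV" if "e \<in> F" for e
    using clocks that F \<tau> by (auto simp: poisson_clocks_def poisson_process_def C_def[abs_def])
  have paths: "indep_vars (\<lambda>_. Q) (\<lambda>e. counting_path (R e)) A"
    using clocks by (simp add: poisson_clocks_def Q_def)
  have incr: "C (i, e) \<omega> = counting_path (R e) \<omega> (\<tau> (Suc i)) - counting_path (R e) \<omega> (\<tau> i)"
    if "e \<in> F" "\<omega> \<in> space M" for i e \<omega>
  proof -
    have "finite (R e \<omega> \<inter> {..b})" for b
      using clocks that F by (auto simp: poisson_clocks_def poisson_process_def)
    then have fin: "finite (R e \<omega> \<inter> {0<..b})" for b by (rule finite_subset[rotated]) auto
    have "R e \<omega> \<inter> {\<tau> i<..\<tau> (Suc i)} = R e \<omega> \<inter> {0<..\<tau> (Suc i)} - R e \<omega> \<inter> {0<..\<tau> i}"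
      using pos[of i] by auto
    moreover have "R e \<omega> \<inter> {0<..\<tau> i} \<subseteq> R e \<omega> \<inter> {0<..\<tau> (Suc i)}"
      using monoD[OF \<tau>(1), of i "Suc i"] by auto
    ultimately show ?thesis
      using fin pos by (simp add: C_def counting_path_def card_Diff_subset)
  qed
  have "indep_vars (\<lambda>_. count_space UNIV) C ({..<m} \<times> F)"
    unfolding indep_vars_def2
  proof (intro conjI ballI)
    fix p assume "p \<in> {..<m} \<times> F"
    then show "random_variable (count_space UNIV) (C p)"
      using ind_e[of "snd p"] by (cases p) (auto simp: indep_vars_def2)
  next
    have rv: "random_variable (count_space UNIV) (C (i, e))" if "e \<in> F" for i e
      using ind_e[OF that] by (auto simp: indep_vars_def2)
    \<comment> \<open>On a finite index set the product formula needs checking only for the full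
      set, because the choice \<open>UNIV\<close> removes an index.\<close>
    show "indep_sets (\<lambda>i. {C i -` A \<inter> space M |A. A \<in> sets (count_space UNIV)}) ({..<m} \<times> F)"
    proof (subst indep_sets_finite, goal_cases)
      case 5
      show ?case
      proof (intro ballI)
        fix X assume "X \<in> Pi ({..<m} \<times> F) (\<lambda>i. {C i -` A \<inter> space M |A. A \<in> sets (count_space UNIV)})"
        then have "\<forall>p\<in>{..<m} \<times> F. \<exists>B. X p = C p -` B \<inter> space M" by (auto simp: Pi_def)
        then obtain B where B: "\<And>p. p \<in> {..<m} \<times> F \<Longrightarrow> X p = C p -` B p \<inter> space M" by metis
        \<comment> \<open>Paths all of whose increments fall in the prescribed sets: this recasts
          the increments of one arc as a single event about its path.\<close>
        define H where "H e = {g \<in> space Q. \<forall>i\<in>{..<m}. g (\<tau> (Suc i)) - g (\<tau> i) \<in> B (i, e)}" for e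
        have H: "H e \<in> sets Q" for e
        proof -
          have [measurable]: "(\<lambda>g. g (\<tau> i)) \<in> measurable Q (count_space UNIV)" for i
            unfolding Q_def using pos by (intro measurable_component_singleton) auto
          show ?thesis unfolding H_def by measurable
        qed
        have HC: "counting_path (R e) -` H e \<inter> space M = (\<Inter>i\<in>{..<m}. C (i, e) -` B (i, e) \<inter> space M)"
          if "e \<in> F" for e
        proof -
          have "counting_path (R e) \<in> measurable M Q"
            using paths that F by (auto simp: indep_vars_def2)
          then show ?thesis
            using incr[OF that] False by (auto simp: H_def dest: measurable_space)
        qed
        have "(\<Inter>p\<in>{..<m} \<times> F. X p) = (\<Inter>e\<in>F. \<Inter>i\<in>{..<m}. C (i, e) -` B (i, e) \<inter> space M)"
          using B by auto
        also have "\<dots> = (\<Inter>e\<in>F. counting_path (R e) -` H e \<inter> space M)"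
          using HC by simp
        also have "prob \<dots> = (\<Prod>e\<in>F. prob (counting_path (R e) -` H e \<inter> space M))"
          using F False H by (intro indep_varsD[OF paths]) auto
        also have "\<dots> = (\<Prod>e\<in>F. prob (\<Inter>i\<in>{..<m}. C (i, e) -` B (i, e) \<inter> space M))"
          using HC by simp
        also have "\<dots> = (\<Prod>e\<in>F. \<Prod>i\<in>{..<m}. prob (C (i, e) -` B (i, e) \<inter> space M))"
          using False by (intro prod.cong refl indep_varsD[OF ind_e]) auto
        also have "\<dots> = (\<Prod>p\<in>{..<m} \<times> F. prob (X p))"
          by (subst prod.swap, subst prod.cartesian_product) (auto intro!: prod.cong simp: B)
        finally show "prob (\<Inter>p\<in>{..<m} \<times> F. X p) = (\<Prod>p\<in>{..<m} \<times> F. prob (X p))" .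
      qed
    next
      case (3 p)
      then show ?case using rv by (auto intro!: measurable_sets)
    qed (use False F in \<open>auto intro!: exI[of _ UNIV]\<close>)
  qed
  then show ?thesis by (simp add: C_def[abs_def])
qed

end

section \<open>Discretised clocks\<close>

text \<open>Constant from \<open>m\<close> on, because \<open>poisson_process\<close> speaks of increments along infinite sequences.\<close>

definition grid :: "real \<Rightarrow> nat \<Rightarrow> nat \<Rightarrow> real" where
  "grid t m i = t * real (min i m) / real m"

lemma grid_mono: "0 \<le> t \<Longrightarrow> mono (grid t m)"
  by (intro monoI) (auto simp: grid_def intro!: divide_right_mono mult_left_mono)

lemma grid_Suc_diff: "i < m \<Longrightarrow> grid t m (Suc i) - grid t m i = t / real m"
  by (simp add: grid_def min_def field_simps)

definition ring_counts :: "('e \<Rightarrow> 'a \<Rightarrow> real set) \<Rightarrow> real \<Rightarrow> nat \<Rightarrow> nat \<Rightarrow> 'a \<Rightarrow> 'e \<Rightarrow> nat" where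
  "ring_counts R t m i \<omega> e = card (R e \<omega> \<inter> {grid t m i<..grid t m (Suc i)})"

text \<open>The intervals are numbered backwards from \<open>t\<close>, as the dual chain runs in reverse time.\<close>

definition dual_mark :: "'e set \<Rightarrow> ('e \<Rightarrow> 'a \<Rightarrow> real set) \<Rightarrow> real \<Rightarrow> nat \<Rightarrow> nat \<Rightarrow> 'a \<Rightarrow> 'e option" where
  "dual_mark F R t m k \<omega> = ring_mark F (ring_counts R t m (m - Suc k) \<omega>)"

lemma ring_mark_cong: "(\<And>e. e \<in> F \<Longrightarrow> c e = c' e) \<Longrightarrow> ring_mark F c = ring_mark F c'"
proof -
  assume "\<And>e. e \<in> F \<Longrightarrow> c e = c' e"
  then have "sole_ring F c = sole_ring F c'" by (simp add: sole_ring_def fun_eq_iff)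
  then show ?thesis by (simp add: ring_mark_def)
qed

lemma ring_mark_closed: "ring_mark F c \<in> insert None (Some ` F)"
proof (cases "ring_mark F c")
  case (Some e)
  then have "e \<in> F" using ring_mark_eq_Some sole_ring_def by metis
  with Some show ?thesis by simp
qed simp

context prob_space
begin

lemma integrable_finite_range:
  fixes g :: "'s \<Rightarrow> real"
  assumes X: "X \<in> measurable M (count_space S)" and "finite S"
  shows "integrable M (\<lambda>\<omega>. g (X \<omega>))"
proof (rule integrable_const_bound)
  show "(\<lambda>\<omega>. g (X \<omega>)) \<in> borel_measurable M"
    by (rule measurable_compose[OF X]) simp
  show "AE \<omega> in M. norm (g (X \<omega>)) \<le> Max ((\<lambda>s. \<bar>g s\<bar>) ` S)"
    using measurable_space[OF X] \<open>finite S\<close> by (intro AE_I2) (auto intro!: Max_ge)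
qed

lemma prob_poisson_increment:
  assumes "poisson_process r T" "0 \<le> s" "s < t" "0 < r"
  shows "prob {\<omega> \<in> space M. card (T \<omega> \<inter> {s<..t}) = n} =
    (r * (t - s)) ^ n / fact n * exp (- (r * (t - s)))"
proof -
  define C where "C \<omega> = card (T \<omega> \<inter> {s<..t})" for \<omega>
  \<comment> \<open>The independence clause is invoked for measurability of the count; this sequence
    makes \<open>{s<..t}\<close> its first interval.\<close>
  define \<tau> :: "nat \<Rightarrow> real" where "\<tau> i = (if i = 0 then s else t)" for i
  have "mono \<tau>" "0 \<le> \<tau> 0" using assms by (auto simp: \<tau>_def mono_def)
  then have "indep_vars (\<lambda>_. count_space UNIV) (\<lambda>i \<omega>. card (T \<omega> \<inter> {\<tau> i<..\<tau> (Suc i)})) UNIV"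
    using assms by (simp add: poisson_process_def)
  then have "random_variable (count_space UNIV) (\<lambda>\<omega>. card (T \<omega> \<inter> {\<tau> 0<..\<tau> (Suc 0)}))"
    unfolding indep_vars_def by blast
  then have C: "C \<in> measurable M (count_space UNIV)" by (simp add: C_def[abs_def] \<tau>_def)
  have "distr M (count_space UNIV) C = measure_pmf (poisson_pmf (r * (t - s)))"
    using assms by (simp add: poisson_process_def C_def[abs_def])
  then have "pmf (poisson_pmf (r * (t - s))) n = measure (distr M (count_space UNIV) C) {n}"
    by (simp add: pmf.rep_eq)
  also have "\<dots> = prob (C -` {n} \<inter> space M)" by (rule measure_distr[OF C]) simp
  also have "C -` {n} \<inter> space M = {\<omega> \<in> space M. card (T \<omega> \<inter> {s<..t}) = n}"
    by (auto simp: C_def)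
  finally show ?thesis using assms by (simp add: pmf_poisson)
qed

section \<open>Law and independence of ring counts and marks\<close>

lemma indep_ring_counts:
  assumes "poisson_clocks A R" "F \<subseteq> A" "finite F" "0 \<le> t"
  shows "indep_vars (\<lambda>_. count_space UNIV) (\<lambda>p \<omega>. ring_counts R t m (fst p) \<omega> (snd p)) ({..<m} \<times> F)"
  unfolding ring_counts_def
  by (rule indep_poisson_increments[OF assms(1-3) grid_mono]) (use assms in \<open>auto simp: grid_def\<close>)

lemma prob_ring_counts:
  assumes clocks: "poisson_clocks A R" "F \<subseteq> A" "finite F" and "0 < t" "i < m"
  shows "prob {\<omega> \<in> space M. \<forall>e\<in>F. ring_counts R t m i \<omega> e = b e} =
      (\<Prod>e\<in>F. (t / m) ^ b e / fact (b e) * exp (- (t / m)))"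
    and "{\<omega> \<in> space M. \<forall>e\<in>F. ring_counts R t m i \<omega> e = b e} \<in> events"
proof -
  let ?C = "\<lambda>p \<omega>. ring_counts R t m (fst p) \<omega> (snd p)"
  have ind: "indep_vars (\<lambda>_. count_space UNIV) ?C ({..<m} \<times> F)"
    using assms by (intro indep_ring_counts) auto
  have rv: "?C (i, e) \<in> measurable M (count_space UNIV)" if "e \<in> F" for e
    using ind that \<open>i < m\<close> unfolding indep_vars_def2 by fastforce
  have ev: "{\<omega> \<in> space M. ring_counts R t m i \<omega> e = n} \<in> events" if "e \<in> F" for e n
    using measurable_sets[OF rv[OF that], of "{n}"] by (simp add: vimage_def Int_def conj_commute)
  show "{\<omega> \<in> space M. \<forall>e\<in>F. ring_counts R t m i \<omega> e = b e} \<in> events"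
    using ev clocks by (intro sets.sets_Collect_finite_All) auto
  have p: "prob {\<omega> \<in> space M. ring_counts R t m i \<omega> e = n} = (t / m) ^ n / fact n * exp (- (t / m))"
    if "e \<in> F" for e n
  proof -
    have "poisson_process 1 (R e)" using clocks that by (auto simp: poisson_clocks_def)
    moreover have "0 \<le> grid t m i" using \<open>0 < t\<close> by (simp add: grid_def)
    moreover have "grid t m i < grid t m (Suc i)"
      using grid_Suc_diff[OF \<open>i < m\<close>, of t] \<open>0 < t\<close> \<open>i < m\<close>
      by (metis diff_gt_0_iff_gt divide_pos_pos gr_implies_not0 not_gr_zero of_nat_0_less_iff)
    ultimately show ?thesis
      using prob_poisson_increment[of 1 "R e" "grid t m i" "grid t m (Suc i)" n]
        grid_Suc_diff[OF \<open>i < m\<close>, of t] by (simp add: ring_counts_def)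
  qed
  show "prob {\<omega> \<in> space M. \<forall>e\<in>F. ring_counts R t m i \<omega> e = b e} =
      (\<Prod>e\<in>F. (t / m) ^ b e / fact (b e) * exp (- (t / m)))"
  proof (cases "F = {}")
    case True
    then show ?thesis by (simp add: prob_space)
  next
    case False
    have "{\<omega> \<in> space M. \<forall>e\<in>F. ring_counts R t m i \<omega> e = b e} =
        (\<Inter>p\<in>{i} \<times> F. ?C p -` {b (snd p)} \<inter> space M)" using False by auto
    also have "prob \<dots> = (\<Prod>p\<in>{i} \<times> F. prob (?C p -` {b (snd p)} \<inter> space M))"
      using False clocks \<open>i < m\<close> by (intro indep_varsD[OF ind]) auto
    also have "\<dots> = (\<Prod>e\<in>F. prob (?C (i, e) -` {b e} \<inter> space M))"
    proof -
      have "{i} \<times> F = Pair i ` F" by auto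
      then show ?thesis by (simp add: prod.reindex inj_on_def)
    qed
    also have "\<dots> = (\<Prod>e\<in>F. (t / m) ^ b e / fact (b e) * exp (- (t / m)))"
      using p by (intro prod.cong refl) (simp add: vimage_def Int_def conj_commute)
    finally show ?thesis .
  qed
qed

text \<open>Mark \<open>k\<close> is a function of the counts in interval \<open>m - Suc k\<close>,
  and distinct \<open>k\<close> below \<open>m\<close> use disjoint blocks of the independent
  counts.\<close>

lemma indep_dual_marks:
  assumes clocks: "poisson_clocks A R" "F \<subseteq> A" "finite F" and "0 \<le> t"
  shows "indep_vars (\<lambda>_. count_space (insert None (Some ` F))) (dual_mark F R t m) {..<m}"
proof -
  let ?C = "\<lambda>p \<omega>. ring_counts R t m (fst p) \<omega> (snd p)"
  let ?K = "\<lambda>k. {m - Suc k} \<times> F"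
  let ?Y = "\<lambda>k g. ring_mark F (\<lambda>e. g (m - Suc k, e))"
  have "indep_vars (\<lambda>k. PiM (?K k) (\<lambda>_. count_space (UNIV :: nat set)))
      (\<lambda>k \<omega>. restrict (\<lambda>p. ?C p \<omega>) (?K k)) {..<m}"
    by (rule indep_vars_restrict[OF indep_ring_counts[OF assms]]) (auto simp: disjoint_family_on_def)
  then have "indep_vars (\<lambda>_. count_space (insert None (Some ` F)))
      (\<lambda>k \<omega>. ?Y k (restrict (\<lambda>p. ?C p \<omega>) (?K k))) {..<m}"
  proof (rule indep_vars_compose2)
    fix k
    \<comment> \<open>A finite product of countable discrete spaces is discrete, so only the range
      of the map has to be checked.\<close>
    have "PiM (?K k) (\<lambda>_. count_space (UNIV :: nat set)) = count_space (PiE (?K k) (\<lambda>_. UNIV))"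
      using clocks by (intro count_space_PiM_finite) auto
    then show "?Y k \<in> measurable (PiM (?K k) (\<lambda>_. count_space (UNIV :: nat set)))
        (count_space (insert None (Some ` F)))"
      using ring_mark_closed by (simp only: measurable_count_space_eq1 space_count_space) blast
  qed
  also have "(\<lambda>k \<omega>. ?Y k (restrict (\<lambda>p. ?C p \<omega>) (?K k))) = dual_mark F R t m"
    by (auto simp: fun_eq_iff dual_mark_def intro!: ring_mark_cong)
  finally show ?thesis .
qed

text \<open>The one ring contributes \<open>t / m\<close>, and each arc of \<open>F\<close> a factor
  \<open>exp (- (t / m))\<close>. The value is the same for all arcs, which balances an arc against
  its reversal in the dual chain.\<close>

lemma prob_sole_ring:
  assumes "poisson_clocks A R" "F \<subseteq> A" "finite F" "0 < t" "i < m" "e \<in> F"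
  shows "prob {\<omega> \<in> space M. sole_ring F (ring_counts R t m i \<omega>) e} = t / m * exp (- (t / m)) ^ card F"
    and "{\<omega> \<in> space M. sole_ring F (ring_counts R t m i \<omega>) e} \<in> events"
proof -
  define b :: "_ \<Rightarrow> nat" where "b e' = (if e' = e then 1 else 0)" for e'
  have eq: "{\<omega> \<in> space M. sole_ring F (ring_counts R t m i \<omega>) e} =
      {\<omega> \<in> space M. \<forall>e'\<in>F. ring_counts R t m i \<omega> e' = b e'}"
    using assms(6) by (simp add: sole_ring_def b_def)
  show "{\<omega> \<in> space M. sole_ring F (ring_counts R t m i \<omega>) e} \<in> events"
    unfolding eq by (rule prob_ring_counts(2)[OF assms(1-5)])
  have "prob {\<omega> \<in> space M. sole_ring F (ring_counts R t m i \<omega>) e} =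
      (\<Prod>e'\<in>F. (t / m) ^ b e' / fact (b e') * exp (- (t / m)))"
    unfolding eq by (rule prob_ring_counts(1)[OF assms(1-5)])
  also have "\<dots> = (\<Prod>e'\<in>F. (if e' = e then t / m else 1)) * (\<Prod>e'\<in>F. exp (- (t / m)))"
    by (subst prod.distrib[symmetric]) (auto simp: b_def intro!: prod.cong)
  finally show "prob {\<omega> \<in> space M. sole_ring F (ring_counts R t m i \<omega>) e} =
      t / m * exp (- (t / m)) ^ card F"
    using assms by simp
qed

text \<open>With \<open>x = card F * (t / m)\<close>, no ring has probability
  \<open>exp (- x)\<close> and one ring \<open>x * exp (- x)\<close>. What remains is quadratic in
  \<open>x\<close>, so that the sum over \<open>m\<close> intervals vanishes as \<open>m\<close>
  grows.\<close>

lemma prob_multiple_rings: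
  assumes "poisson_clocks A R" "F \<subseteq> A" "finite F" "0 < t" "i < m"
  defines "B \<equiv> {\<omega> \<in> space M. \<not> ((\<forall>e\<in>F. ring_counts R t m i \<omega> e = 0) \<or>
    (\<exists>e. sole_ring F (ring_counts R t m i \<omega>) e))}"
  shows "prob B \<le> (card F * (t / m))\<^sup>2" and "B \<in> events"
proof -
  let ?Z = "{\<omega> \<in> space M. \<forall>e\<in>F. ring_counts R t m i \<omega> e = 0}"
  let ?S = "\<lambda>e. {\<omega> \<in> space M. sole_ring F (ring_counts R t m i \<omega>) e}"
  have Z: "?Z \<in> events" "prob ?Z = exp (- (t / m)) ^ card F"
    using prob_ring_counts[OF assms(1-5), of "\<lambda>_. 0"] by simp_all
  have S: "?S e \<in> events" "prob (?S e) = t / m * exp (- (t / m)) ^ card F" if "e \<in> F" for e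
    using prob_sole_ring[OF assms(1-5) that] by simp_all
  have US: "(\<Union>e\<in>F. ?S e) \<in> events" using S assms(3) by auto
  have "prob (\<Union>e\<in>F. ?S e) = (\<Sum>e\<in>F. prob (?S e))"
    using S assms(3)
    by (intro finite_measure_finite_Union) (auto simp: disjoint_family_on_def dest: sole_ring_unique)
  then have pS: "prob (\<Union>e\<in>F. ?S e) = card F * (t / m) * exp (- (t / m)) ^ card F"
    using S by simp
  have B_eq: "B = space M - (?Z \<union> (\<Union>e\<in>F. ?S e))"
    by (auto simp: B_def sole_ring_def)
  show "B \<in> events" unfolding B_eq using Z US by auto
  have "prob (?Z \<union> (\<Union>e\<in>F. ?S e)) = prob ?Z + prob (\<Union>e\<in>F. ?S e)"
    using Z US by (intro finite_measure_Union) (auto simp: sole_ring_def)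
  then have "prob B = 1 - (1 + card F * (t / m)) * exp (- (t / m)) ^ card F"
    unfolding B_eq using Z US pS by (subst prob_compl) (auto simp: algebra_simps)
  also have "exp (- (t / m)) ^ card F = exp (- (card F * (t / m)))"
    by (simp add: exp_of_nat_mult[symmetric])
  also have "1 - (1 + x) * exp (- x) \<le> x\<^sup>2" if "x \<ge> 0" for x :: real
  proof -
    have "(1 + x) * (1 - x) \<le> (1 + x) * exp (- x)"
      using exp_ge_add_one_self[of "- x"] that by (intro mult_left_mono) auto
    then show ?thesis by (simp add: algebra_simps power2_eq_square)
  qed
  finally show "prob B \<le> (card F * (t / m))\<^sup>2" using assms(4) by simp
qed

end

section \<open>Extinction of the dual chain\<close>

lemma dual_step_closed:
  assumes "finite W" "j \<in> insert None (Some ` F)" "\<And>e. e \<in> F \<Longrightarrow> fst e \<in> W" "A \<subseteq> W" "card A \<le> N"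
  shows "dual_step N j A \<subseteq> W \<and> card (dual_step N j A) \<le> N"
proof (cases "A = {} \<or> N \<le> card A")
  case True
  then have "dual_step N j A = A" by (rule dual_step_frozen)
  with assms show ?thesis by simp
next
  case False
  then have act: "A \<noteq> {}" "card A < N" by auto
  have "finite A" using assms finite_subset by blast
  show ?thesis
  proof (cases j)
    case None
    then show ?thesis using act assms by (simp add: dual_step_active)
  next
    case (Some e)
    obtain u w where e: "e = (u, w)" by (cases e)
    have "u \<in> W" using assms(2,3) Some e by fastforce
    moreover have "card (insert u A) \<le> N" using act \<open>finite A\<close> by (simp add: card_insert_if)
    moreover have "card (A - {u}) \<le> card A" using \<open>finite A\<close> by (rule card_mono) auto
    ultimately show ?thesis using act assms(4) Some e by (auto simp: dual_step_active)
  qed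
qed

context prob_space
begin

abbreviation dual_set :: "nat \<Rightarrow> 'v \<Rightarrow> ('v \<times> 'v) set \<Rightarrow> ('v \<times> 'v \<Rightarrow> 'a \<Rightarrow> real set) \<Rightarrow>
    real \<Rightarrow> nat \<Rightarrow> nat \<Rightarrow> 'a \<Rightarrow> 'v set" where
  "dual_set N v F R t m k \<omega> \<equiv> iter_marks (dual_step N) {v} (\<lambda>k. dual_mark F R t m k \<omega>) k"

text \<open>While the chain is active, each step lowers the mean potential by at least
  \<open>h\<close>, starting from at most \<open>2 * N\<close>. This bounds the probability of being
  active after \<open>m\<close> steps; reaching size \<open>N\<close> is bounded by Markov's
  inequality for the potential, which is \<open>N\<close> squared there.\<close>

lemma dual_set_survival:
  fixes R :: "'v \<times> 'v \<Rightarrow> 'a \<Rightarrow> real set" and N :: nat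
  assumes clocks: "poisson_clocks E R" and E: "\<And>u w. (u, w) \<in> E \<Longrightarrow> (w, u) \<in> E"
    and W: "finite W" "v \<in> W" and F: "F = {e \<in> E. fst e \<in> W}" "finite F"
    and boundary: "\<And>A. A \<subseteq> W \<Longrightarrow> A \<noteq> {} \<Longrightarrow> \<exists>a b. (a, b) \<in> E \<and> a \<in> A \<and> b \<notin> A"
    and pos: "0 < N" "0 < t" "0 < m"
  shows "prob {\<omega> \<in> space M. dual_set N v F R t m m \<omega> \<noteq> {}} \<le>
      2 * N / (t * exp (- (t / m)) ^ card F) + 2 / N"
    and "{\<omega> \<in> space M. dual_set N v F R t m m \<omega> \<noteq> {}} \<in> events"
proof -
  define J where "J = dual_mark F R t m"
  define T where "T = insert None (Some ` F)"
  define S where "S = {A. A \<subseteq> W \<and> card A \<le> N}"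
  define X where "X k \<omega> = dual_set N v F R t m k \<omega>" for k \<omega>
  \<comment> \<open>The probability that the mark is a given arc of \<open>F\<close>;
    \<open>h * m\<close> tends to \<open>t\<close> as the grid is refined.\<close>
  define h where "h = t / m * exp (- (t / m)) ^ card F"
  define act :: "'v set \<Rightarrow> real" where "act A = (if A \<noteq> {} \<and> card A < N then 1 else 0)" for A
  have FE: "F \<subseteq> E" using F by auto
  have h: "0 < h" using pos by (simp add: h_def)
  have fin: "finite S" "finite T" using W F by (auto simp: S_def T_def)
  have ind: "indep_vars (\<lambda>_. count_space T) J {..<m}"
    unfolding J_def T_def using clocks FE F pos by (intro indep_dual_marks) auto
  have vS: "{v} \<in> S" using W pos by (auto simp: S_def)
  have closed: "dual_step N j A \<in> S" if "j \<in> T" "A \<in> S" for j A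
  proof -
    have "\<And>e. e \<in> F \<Longrightarrow> fst e \<in> W" using F by blast
    then have "dual_step N j A \<subseteq> W \<and> card (dual_step N j A) \<le> N"
      using that by (intro dual_step_closed[OF W(1), of j F]) (auto simp: T_def S_def)
    then show ?thesis by (simp add: S_def)
  qed
  have J_meas: "J k \<in> measurable M (count_space T)" if "k < m" for k
    using ind that by (auto simp: indep_vars_def2)
  have J_Some: "prob {\<omega> \<in> space M. J k \<omega> = Some e} = h" if "k < m" "e \<in> F" for k e
    using prob_sole_ring(1)[OF clocks FE F(2) pos(2) _ that(2), of "m - Suc k" m] that
    by (simp add: J_def dual_mark_def ring_mark_eq_Some h_def)
  have J_sum: "(\<Sum>j\<in>T. prob {\<omega> \<in> space M. J k \<omega> = j}) = 1" if "k < m" for k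
    using expectation_finite_pair[OF fin(2) _ J_meas[OF that], of "{()}" "\<lambda>_. ()" "\<lambda>_ _. 1"]
    by (simp add: prob_space)
  have step: "expectation (\<lambda>\<omega>. \<phi> (X (Suc k) \<omega>)) =
      expectation (\<lambda>\<omega>. \<Sum>j\<in>T. prob {\<omega> \<in> space M. J k \<omega> = j} * \<phi> (dual_step N j (X k \<omega>)))"
    if "k < m" for k and \<phi> :: "'v set \<Rightarrow> real"
    using expectation_iter_marks_Suc(1)[OF ind fin vS closed that, where \<phi> = \<phi>]
    unfolding X_def J_def by simp
  have X_Suc: "X (Suc k) \<omega> = dual_step N (J k \<omega>) (X k \<omega>)" for k \<omega>
    by (simp add: X_def J_def)
  have X_meas: "X k \<in> measurable M (count_space S)" if "k \<le> m" for k
    using that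
  proof (cases "k < m")
    case True
    then show ?thesis
      using expectation_iter_marks_Suc(2)[OF ind fin vS closed True] unfolding X_def J_def by simp
  next
    \<comment> \<open>The general lemma gives measurability only before the last step, so time
      \<open>m\<close> takes one more step.\<close>
    case False
    then obtain k' where k: "k = Suc k'" "k' < m" using \<open>k \<le> m\<close> pos by (cases k) auto
    have X': "X k' \<in> measurable M (count_space S)"
      using expectation_iter_marks_Suc(2)[OF ind fin vS closed k(2)] unfolding X_def J_def by simp
    have "(\<lambda>\<omega>. (J k' \<omega>, X k' \<omega>)) \<in> measurable M (count_space T \<Otimes>\<^sub>M count_space S)"
      by (intro measurable_Pair J_meas X' k)
    also have "count_space T \<Otimes>\<^sub>M count_space S = count_space (T \<times> S)"
      by (rule pair_measure_count_space) (use fin in auto)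
    finally have "(\<lambda>\<omega>. case (J k' \<omega>, X k' \<omega>) of (j, A) \<Rightarrow> dual_step N j A) \<in> measurable M (count_space S)"
      by (rule measurable_compose) (use closed in auto)
    then show ?thesis by (simp add: k X_Suc[abs_def])
  qed
  note int = integrable_finite_range[OF X_meas fin(1)]
  have XS: "X k \<omega> \<in> S" if "k \<le> m" "\<omega> \<in> space M" for k \<omega>
    using measurable_space[OF X_meas[OF that(1)] that(2)] by simp
  \<comment> \<open>Frozen states are absorbing, so activity never resumes.\<close>
  have act_decr: "expectation (\<lambda>\<omega>. act (X (Suc k) \<omega>)) \<le> expectation (\<lambda>\<omega>. act (X k \<omega>))"
    if "k < m" for k
  proof (rule integral_mono)
    fix \<omega>
    have "dual_step N j A = A" if "act A = 0" for j A
      using that by (intro dual_step_frozen) (auto simp: act_def split: if_splits)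
    then show "act (X (Suc k) \<omega>) \<le> act (X k \<omega>)"
      by (cases "act (X k \<omega>) = 0") (auto simp: X_Suc act_def)
  qed (use int that in auto)
  \<comment> \<open>The mark \<open>None\<close> changes nothing and all arcs carry the weight
    \<open>h\<close>, so the mean change is \<open>h\<close> times the sum in
    \<open>potential_drift\<close>.\<close>
  have drift: "(\<Sum>j\<in>T. prob {\<omega> \<in> space M. J k \<omega> = j} * potential N (dual_step N j A)) \<le>
      potential N A - h * act A" if "k < m" "A \<in> S" for k A
  proof -
    let ?q = "\<lambda>j. prob {\<omega> \<in> space M. J k \<omega> = j}"
    let ?d = "\<lambda>j. potential N (dual_step N j A) - potential N A"
    have "(\<Sum>j\<in>T. ?q j * potential N (dual_step N j A)) =
        (\<Sum>j\<in>T. ?q j) * potential N A + (\<Sum>j\<in>T. ?q j * ?d j)"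
      by (simp add: right_diff_distrib sum_subtractf sum_distrib_right)
    also have "(\<Sum>j\<in>T. ?q j * ?d j) \<le> - (h * act A)"
    proof (cases "A \<noteq> {} \<and> card A < N")
      case False
      then have "dual_step N j A = A" for j by (intro dual_step_frozen) auto
      then show ?thesis using False by (auto simp: act_def)
    next
      case True
      then have A: "A \<subseteq> W" "finite A" "A \<noteq> {}" "card A < N"
        using that W finite_subset by (auto simp: S_def)
      obtain a b where ab: "(a, b) \<in> E" "a \<in> A" "b \<notin> A" using boundary A by blast
      have "(\<Sum>j\<in>T. ?q j * ?d j) = ?q None * ?d None + (\<Sum>e\<in>F. ?q (Some e) * ?d (Some e))"
        using F by (simp add: T_def sum.reindex)
      also have "\<dots> = h * (\<Sum>e\<in>F. ?d (Some e))"
        using A that by (simp add: dual_step_active(1) J_Some sum_distrib_left)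
      also have "\<dots> \<le> h * (- 1)"
        using potential_drift[OF E F A ab] h by (intro mult_left_mono) auto
      finally show ?thesis using True by (simp add: act_def)
    qed
    finally show ?thesis using J_sum[OF that(1)] by simp
  qed
  \<comment> \<open>The total loss up to \<open>k\<close> is a sum of \<open>h\<close> times earlier
    activity probabilities; as these decrease, \<open>k\<close> times the current one may replace
    them.\<close>
  have evol: "expectation (\<lambda>\<omega>. potential N (X k \<omega>)) + h * k * expectation (\<lambda>\<omega>. act (X k \<omega>)) \<le> 2 * N"
    if "k \<le> m" for k
    using that
  proof (induction k)
    case 0
    then show ?case by (simp add: X_def potential_def prob_space)
  next
    case (Suc k)
    have "expectation (\<lambda>\<omega>. potential N (X (Suc k) \<omega>)) \<le>
        expectation (\<lambda>\<omega>. potential N (X k \<omega>) - h * act (X k \<omega>))"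
      unfolding step[OF Suc_le_lessD[OF Suc.prems]]
      using Suc.prems XS drift
      by (intro integral_mono Bochner_Integration.integrable_diff int integrable_mult_right) auto
    also have "\<dots> = expectation (\<lambda>\<omega>. potential N (X k \<omega>)) - h * expectation (\<lambda>\<omega>. act (X k \<omega>))"
      using Suc.prems int by simp
    finally have *: "expectation (\<lambda>\<omega>. potential N (X (Suc k) \<omega>)) \<le> \<dots>" .
    have "h * Suc k * expectation (\<lambda>\<omega>. act (X (Suc k) \<omega>)) \<le> h * Suc k * expectation (\<lambda>\<omega>. act (X k \<omega>))"
      using act_decr[of k] Suc.prems h by (intro mult_left_mono) auto
    with * Suc show ?case by (simp add: algebra_simps)
  qed
  have pot_nonneg: "0 \<le> potential N A" if "A \<in> S" for A
    using that by (auto simp: potential_def S_def)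
  have "X m -` (S - {{}}) \<inter> space M \<in> events"
    by (rule measurable_sets[OF X_meas]) auto
  also have "X m -` (S - {{}}) \<inter> space M = {\<omega> \<in> space M. X m \<omega> \<noteq> {}}"
    using XS[of m] by auto
  finally have ev: "{\<omega> \<in> space M. X m \<omega> \<noteq> {}} \<in> events" .
  then show "{\<omega> \<in> space M. dual_set N v F R t m m \<omega> \<noteq> {}} \<in> events" by (simp add: X_def)
  have "prob {\<omega> \<in> space M. X m \<omega> \<noteq> {}} = expectation (indicator {\<omega> \<in> space M. X m \<omega> \<noteq> {}})"
    using ev by simp
  \<comment> \<open>A nonempty set either is active or has size exactly \<open>N\<close>, and then
    the second term equals 1.\<close>
  also have "\<dots> \<le> expectation (\<lambda>\<omega>. act (X m \<omega>) + potential N (X m \<omega>) / (real N)\<^sup>2)"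
  proof (rule integral_mono)
    show "integrable M (indicat_real {\<omega> \<in> space M. X m \<omega> \<noteq> {}})"
      using ev by (simp add: emeasure_eq_measure)
    show "integrable M (\<lambda>\<omega>. act (X m \<omega>) + potential N (X m \<omega>) / (real N)\<^sup>2)"
      by (intro Bochner_Integration.integrable_add integrable_divide int) auto
    fix \<omega> assume \<omega>: "\<omega> \<in> space M"
    have p0: "0 \<le> potential N (X m \<omega>) / (real N)\<^sup>2" using pot_nonneg XS[OF _ \<omega>] by simp
    have ind_le: "indicat_real {\<omega> \<in> space M. X m \<omega> \<noteq> {}} \<omega> \<le> (if X m \<omega> = {} then 0 else 1)"
      by (simp add: indicator_def)
    show "indicat_real {\<omega> \<in> space M. X m \<omega> \<noteq> {}} \<omega> \<le>
        act (X m \<omega>) + potential N (X m \<omega>) / (real N)\<^sup>2"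
    proof (cases "card (X m \<omega>) = N")
      case True
      then have "potential N (X m \<omega>) / (real N)\<^sup>2 = 1"
        using pos unfolding potential_def by (simp add: power2_eq_square)
      moreover have "0 \<le> act (X m \<omega>)" by (simp add: act_def)
      moreover have "indicat_real {\<omega> \<in> space M. X m \<omega> \<noteq> {}} \<omega> \<le> 1" by (simp add: indicator_def)
      ultimately show ?thesis by linarith
    next
      case False
      then have "card (X m \<omega>) < N" using XS[of m \<omega>] \<omega> by (auto simp: S_def)
      then have "act (X m \<omega>) = (if X m \<omega> = {} then 0 else 1)" by (simp add: act_def)
      then show ?thesis using ind_le p0 by linarith
    qed
  qed
  also have "\<dots> = expectation (\<lambda>\<omega>. act (X m \<omega>)) + expectation (\<lambda>\<omega>. potential N (X m \<omega>)) / (real N)\<^sup>2"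
    using int by simp
  also have "\<dots> \<le> 2 * N / (h * m) + 2 * N / (real N)\<^sup>2"
  proof (intro add_mono divide_right_mono)
    have "0 \<le> expectation (\<lambda>\<omega>. potential N (X m \<omega>))"
      using pot_nonneg XS[of m] by (intro Bochner_Integration.integral_nonneg_AE AE_I2) auto
    then have "h * m * expectation (\<lambda>\<omega>. act (X m \<omega>)) \<le> 2 * N" using evol[of m] by simp
    then show "expectation (\<lambda>\<omega>. act (X m \<omega>)) \<le> 2 * N / (h * m)"
      using h pos by (simp add: pos_le_divide_eq mult.commute)
    have "0 \<le> h * m * expectation (\<lambda>\<omega>. act (X m \<omega>))"
      using h by (intro mult_nonneg_nonneg Bochner_Integration.integral_nonneg_AE AE_I2) (auto simp: act_def)
    then show "expectation (\<lambda>\<omega>. potential N (X m \<omega>)) \<le> 2 * N" using evol[of m] by simp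
  qed auto
  also have "h * m = t * exp (- (t / m)) ^ card F" using pos by (simp add: h_def)
  also have "2 * N / (real N)\<^sup>2 = 2 / N" using pos by (simp add: power2_eq_square)
  finally show "prob {\<omega> \<in> space M. dual_set N v F R t m m \<omega> \<noteq> {}} \<le>
      2 * N / (t * exp (- (t / m)) ^ card F) + 2 / N"
    by (simp add: X_def)
qed

text \<open>For every \<open>m\<close>, \<open>B\<close> is covered by survival of the dual chain
  and the intervals with several rings. As \<open>B\<close> does not depend on \<open>m\<close>, the
  grid can be refined with \<open>W\<close> fixed. Taking a subset \<open>B\<close> asks
  measurability only of the covering events.\<close>

lemma prob_confined_le:
  fixes R :: "'v \<times> 'v \<Rightarrow> 'a \<Rightarrow> real set" and N :: nat
  assumes clocks: "poisson_clocks E R" and E: "\<And>u w. (u, w) \<in> E \<Longrightarrow> (w, u) \<in> E"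
    and W: "finite W" "v \<in> W" and F: "F = {e \<in> E. fst e \<in> W}" "finite F"
    and boundary: "\<And>A. A \<subseteq> W \<Longrightarrow> A \<noteq> {} \<Longrightarrow> \<exists>a b. (a, b) \<in> E \<and> a \<in> A \<and> b \<notin> A"
    and pos: "0 < N" "0 < t"
    and B: "B \<subseteq> {\<omega> \<in> space M. \<exists>x. confined_at E W (\<lambda>e. R e \<omega>) 0 x t v}"
  shows "prob B \<le> 2 * N / t + 2 / N"
proof -
  have FE: "F \<subseteq> E" using F by auto
  define b where "b m = 2 * N / (t * exp (- (t / real m)) ^ card F) + 2 / N +
    m * (card F * (t / real m))\<^sup>2" for m :: nat
  have "prob B \<le> b m" if "0 < m" for m
  proof -
    define D where "D = {\<omega> \<in> space M. dual_set N v F R t m m \<omega> \<noteq> {}}"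
    define Z where "Z i = {\<omega> \<in> space M. \<not> ((\<forall>e\<in>F. ring_counts R t m i \<omega> e = 0) \<or>
      (\<exists>e. sole_ring F (ring_counts R t m i \<omega>) e))}" for i
    have Z: "prob (Z i) \<le> (card F * (t / m))\<^sup>2" "Z i \<in> events" if "i < m" for i
      unfolding Z_def
      by (rule prob_multiple_rings[OF clocks FE F(2) pos(2) that])+
    have D: "prob D \<le> 2 * N / (t * exp (- (t / m)) ^ card F) + 2 / N" "D \<in> events"
      unfolding D_def by (rule dual_set_survival[OF clocks E W F boundary pos that]; assumption)+
    have "B \<subseteq> D \<union> (\<Union>i\<in>{..<m}. Z i)"
    proof
      fix \<omega> assume "\<omega> \<in> B"
      then obtain x where \<omega>: "\<omega> \<in> space M" and x: "confined_at E W (\<lambda>e. R e \<omega>) 0 x t v"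
        using B by blast
      have ends: "grid t m 0 = 0" "grid t m m = t" using that by (auto simp: grid_def)
      show "\<omega> \<in> D \<union> (\<Union>i\<in>{..<m}. Z i)"
      proof (cases "\<omega> \<in> (\<Union>i\<in>{..<m}. Z i)")
        case False
        have "iter_marks (dual_step N) {v} (\<lambda>k. ring_mark F (ring_counts R t m (m - Suc k) \<omega>)) m \<noteq> {}"
        proof (rule dual_chain_nonempty)
          show "confined_at E W (\<lambda>e. R e \<omega>) (grid t m 0) x (grid t m m) v" using x ends by simp
          show "mono (grid t m)" using pos by (intro grid_mono) auto
          show "finite (R e \<omega> \<inter> {..s})" if "e \<in> E" for e s
            using clocks \<omega> that by (auto simp: poisson_clocks_def poisson_process_def)
          show "(\<lambda>i. ring_counts R t m i \<omega>) = (\<lambda>i e. card (R e \<omega> \<inter> {grid t m i<..grid t m (Suc i)}))"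
            by (simp add: ring_counts_def fun_eq_iff)
          show "(\<forall>e\<in>F. ring_counts R t m i \<omega> e = 0) \<or> (\<exists>e. sole_ring F (ring_counts R t m i \<omega>) e)"
            if "i < m" for i
            using False \<omega> that by (auto simp: Z_def)
        qed (use F pos in auto)
        then show ?thesis using \<omega> by (simp add: D_def dual_mark_def)
      qed simp
    qed
    then have "prob B \<le> prob (D \<union> (\<Union>i\<in>{..<m}. Z i))"
      using D Z by (intro finite_measure_mono) auto
    also have "\<dots> \<le> prob D + prob (\<Union>i\<in>{..<m}. Z i)"
      using D Z by (intro measure_Un_le) auto
    also have "prob (\<Union>i\<in>{..<m}. Z i) \<le> (\<Sum>i<m. prob (Z i))"
      using Z by (intro finite_measure_subadditive_finite) auto
    also have "\<dots> \<le> (\<Sum>i<m. (card F * (t / m))\<^sup>2)"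
      using Z by (intro sum_mono) auto
    finally show ?thesis using D by (simp add: b_def)
  qed
  \<comment> \<open>The limit is left in the shape produced by the limit rules;
    \<open>exp (- 0) ^ card F\<close> is 1, and the error term behaves like a constant over
    \<open>m\<close>.\<close>
  moreover have "b \<longlonglongrightarrow> 2 * N / (t * exp (- 0) ^ card F) + 2 / N + 0"
  proof -
    have l1: "(\<lambda>m. t / real m) \<longlonglongrightarrow> 0" by (rule lim_const_over_n)
    have "(\<lambda>m. (card F * t)\<^sup>2 / real m) \<longlonglongrightarrow> 0" by (rule lim_const_over_n)
    moreover have "(card F * t)\<^sup>2 / real m = m * (card F * (t / real m))\<^sup>2" for m
      by (cases "m = 0") (simp_all add: power2_eq_square field_simps)
    ultimately have l2: "(\<lambda>m. m * (card F * (t / real m))\<^sup>2) \<longlonglongrightarrow> 0" by simp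
    have "(\<lambda>m. t * exp (- (t / real m)) ^ card F) \<longlonglongrightarrow> t * exp (- 0) ^ card F"
      by (intro tendsto_mult tendsto_power tendsto_exp tendsto_minus tendsto_const l1)
    then show ?thesis
      unfolding b_def using pos
      by (intro tendsto_add[OF tendsto_add l2] tendsto_divide tendsto_const) auto
  qed
  ultimately have "prob B \<le> 2 * N / (t * exp (- 0) ^ card F) + 2 / N + 0"
    by (intro LIMSEQ_le_const) (auto intro!: exI[of _ 1])
  then show ?thesis by simp
qed

end

section \<open>Occupation probabilities\<close>

lemma (in prob_space) jump_event_measurable:
  assumes X [measurable]: "\<And>e k. X e k \<in> borel_measurable M"
    and nbrs: "\<And>u. countable {w. (u, w) \<in> parcs G}"
  shows "{\<omega> \<in> space M. jump_ok G X x l \<omega> \<and> jump_pos x l = v \<and> jump_time X x l \<omega> \<le> t \<and>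
    (\<forall>w\<in>{w. (v, w) \<in> parcs G}. \<forall>j. \<not> (jump_time X x l \<omega> < X (v, w) j \<omega> \<and> X (v, w) j \<omega> \<le> t))}
    \<in> events"
proof -
  have time [measurable]: "jump_time X x l \<in> borel_measurable M" for l
    by (induction l) auto
  have ok: "{\<omega> \<in> space M. jump_ok G X x l \<omega>} \<in> events" for l
  proof (induction l)
    case (Cons p l)
    have *: "{\<omega> \<in> space M. \<forall>w\<in>{w. (jump_pos x l, w) \<in> parcs G}. \<forall>j.
        \<not> (jump_time X x l \<omega> < X (jump_pos x l, w) j \<omega> \<and>
          X (jump_pos x l, w) j \<omega> < X (jump_pos x l, fst p) (snd p) \<omega>)} \<in> events"
      by (rule sets.sets_Collect_countable_All'[OF _ nbrs]) measurable
    show ?case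
      unfolding jump_ok.simps
      by (intro sets.sets_Collect_conj sets.sets_Collect_const Cons *) measurable
  qed simp
  have *: "{\<omega> \<in> space M. \<forall>w\<in>{w. (v, w) \<in> parcs G}. \<forall>j.
      \<not> (jump_time X x l \<omega> < X (v, w) j \<omega> \<and> X (v, w) j \<omega> \<le> t)} \<in> events"
    by (rule sets.sets_Collect_countable_All'[OF _ nbrs]) measurable
  show ?thesis
    by (intro sets.sets_Collect_conj sets.sets_Collect_const ok *) measurable
qed

text \<open>Link between jump lists and confined walks: a list names finitely many vertices, and any
  \<open>W\<close> containing them and the start confines the walk.\<close>

lemma confined_at_jumps:
  assumes K: "\<And>e. e \<in> parcs G \<Longrightarrow> K e = {X e j \<omega> | j. 0 < X e j \<omega>}"
    and "x \<in> W" "jump_ok G X x l \<omega>" "fst ` set l \<subseteq> W"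
  shows "confined_at (parcs G) W K 0 x (jump_time X x l \<omega>) (jump_pos x l)"
  using assms(3,4)
proof (induction l)
  case Nil
  then show ?case using \<open>x \<in> W\<close> by (auto intro: confined_at.start)
next
  case (Cons p l)
  let ?u = "jump_pos x l" and ?s = "jump_time X x l \<omega>" and ?t = "X (jump_pos x l, fst p) (snd p) \<omega>"
  have ok: "jump_ok G X x l \<omega>" "(?u, fst p) \<in> parcs G" "?s < ?t"
    "\<And>w j. (?u, w) \<in> parcs G \<Longrightarrow> \<not> (?s < X (?u, w) j \<omega> \<and> X (?u, w) j \<omega> < ?t)"
    using Cons.prems by auto
  have "0 \<le> ?s" using jump_time_nonneg[OF ok(1)] .
  with ok have "?t \<in> K (?u, fst p)" using K[OF ok(2)] by force
  moreover have "K (?u, w) \<inter> {?s<..<?t} = {}" if "(?u, w) \<in> parcs G" for w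
    using K[OF that] ok(4)[OF that] by fastforce
  ultimately show ?case
    using Cons ok by (auto intro!: confined_at.jump[of _ _ _ _ _ ?s ?u])
qed

text \<open>If no arc left \<open>A\<close>, everything reachable from a point of \<open>A\<close>
  would lie in \<open>A\<close>; by connectedness that is the whole infinite vertex set. This keeps
  the dual chain moving.\<close>

lemma boundary_arc:
  assumes "pair_bidirected_digraph G" "Digraph_Component.connected (with_proj G)"
    "infinite (pverts G)" "finite A" "A \<subseteq> pverts G" "A \<noteq> {}"
  shows "\<exists>a b. (a, b) \<in> parcs G \<and> a \<in> A \<and> b \<notin> A"
proof (rule ccontr)
  assume no: "\<nexists>a b. (a, b) \<in> parcs G \<and> a \<in> A \<and> b \<notin> A"
  interpret pair_bidirected_digraph G by fact
  have "(u, w) \<in> parcs G \<Longrightarrow> (w, u) \<in> parcs G" for u w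
    using pair_sym_arcs by (auto simp: symmetric_def sym_def)
  \<comment> \<open>Connectedness is defined through the symmetric closure, which for a bidirected
    graph is the arc set itself.\<close>
  then have arcs: "arcs_ends (with_proj (mk_symmetric (with_proj G))) = parcs G"
    by (auto simp: parcs_mk_symmetric)
  obtain a where a: "a \<in> A" using assms by blast
  have "b \<in> A" if "b \<in> pverts G" for b
  proof -
    have "(a, b) \<in> rtrancl_on (pverts G) (parcs G)"
      using assms(2,5) a that arcs
      unfolding Digraph_Component.connected_def strongly_connected_def reachable_def by auto
    then show ?thesis using a no by (induction rule: rtrancl_on_induct) auto
  qed
  then have "pverts G \<subseteq> A" by blast
  then show False using assms finite_subset by blast
qed

text \<open>The bound for confined walks does not involve \<open>W\<close>, so it survives an
  exhaustion of the graph by finite sets \<open>W n\<close> and continuity of the measure along the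
  events \<open>B n\<close>.\<close>

lemma (in prob_space) occupation_prob_le:
  assumes G: "pair_bidirected_digraph G" "Digraph_Component.connected (with_proj G)"
    "locally_finite G" "infinite (pverts G)"
    and R: "poisson_clocks (parcs G) R"
    and v: "v \<in> pverts G" and pos: "0 < N" "0 < t"
  shows "occupation_prob G R t v \<le> 2 * real N / t + 2 / real N"
proof -
  interpret pair_bidirected_digraph G by fact
  have cV: "countable (pverts G)" by (rule countable_pverts[OF G(1-3)])
  have "\<exists>X :: nat \<Rightarrow> 'a \<Rightarrow> real. (\<forall>k. X k \<in> borel_measurable M) \<and>
      (e \<in> parcs G \<longrightarrow> (\<forall>\<omega>\<in>space M. R e \<omega> = {X k \<omega> | k. 0 < X k \<omega>}))" for e
  proof (cases "e \<in> parcs G")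
    case True
    then have "poisson_process 1 (R e)" using R by (simp add: poisson_clocks_def)
    then show ?thesis by (rule ring_times_measurable) blast
  next
    case False
    then show ?thesis by (intro exI[of _ "\<lambda>_ _. 0"]) simp
  qed
  then have "\<exists>X :: _ \<Rightarrow> nat \<Rightarrow> 'a \<Rightarrow> real. \<forall>e. (\<forall>k. X e k \<in> borel_measurable M) \<and>
      (e \<in> parcs G \<longrightarrow> (\<forall>\<omega>\<in>space M. R e \<omega> = {X e k \<omega> | k. 0 < X e k \<omega>}))"
    by (intro choice allI)
  then obtain X :: "_ \<Rightarrow> nat \<Rightarrow> 'a \<Rightarrow> real" where
    "\<forall>e. (\<forall>k. X e k \<in> borel_measurable M) \<and>
      (e \<in> parcs G \<longrightarrow> (\<forall>\<omega>\<in>space M. R e \<omega> = {X e k \<omega> | k. 0 < X e k \<omega>}))" ..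
  then have X: "\<And>e k. X e k \<in> borel_measurable M"
    "\<And>e \<omega>. e \<in> parcs G \<Longrightarrow> \<omega> \<in> space M \<Longrightarrow> R e \<omega> = {X e k \<omega> | k. 0 < X e k \<omega>}"
    by blast+
  have nbrs: "countable {w. (u, w) \<in> parcs G}" for u
    by (rule countable_subset[OF _ cV]) (auto dest: in_arcsD2)
  define Q where "Q x l = {\<omega> \<in> space M. jump_ok G X x l \<omega> \<and> jump_pos x l = v \<and> jump_time X x l \<omega> \<le> t \<and>
    (\<forall>w\<in>{w. (v, w) \<in> parcs G}. \<forall>j. \<not> (jump_time X x l \<omega> < X (v, w) j \<omega> \<and> X (v, w) j \<omega> \<le> t))}" for x l
  have Q: "Q x l \<in> events" for x l
    unfolding Q_def by (rule jump_event_measurable[OF X(1) nbrs])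
  \<comment> \<open>The vertex \<open>v\<close> is put into every \<open>W n\<close> because the
    dual chain starts from \<open>{v}\<close>.\<close>
  define W where "W n = insert v (from_nat_into (pverts G) ` {..n})" for n :: nat
  have W: "finite (W n)" "v \<in> W n" "W n \<subseteq> pverts G" for n
    using v from_nat_into[of "pverts G"] by (auto simp: W_def)
  have W_mono: "W i \<subseteq> W n" if "i \<le> n" for i n using that by (auto simp: W_def)
  have W_cover: "\<exists>n. C \<subseteq> W n" if "finite C" "C \<subseteq> pverts G" for C
    using that
  proof (induction C)
    case (insert a C)
    then obtain n where n: "C \<subseteq> W n" by auto
    obtain i where "from_nat_into (pverts G) i = a"
      using from_nat_into_surj[OF cV, of a] insert.prems by auto
    then have "a \<in> W i" by (auto simp: W_def)
    then have "insert a C \<subseteq> W (max i n)"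
      using n W_mono[of n "max i n"] W_mono[of i "max i n"] by auto
    then show ?case by blast
  qed simp
  \<comment> \<open>Built from jump lists inside \<open>W n\<close> rather than from
    \<open>confined_at\<close>, so that it is a countable union of events.\<close>
  define B where "B n = (\<Union>x\<in>W n. \<Union>l\<in>lists (W n \<times> UNIV). Q x l)" for n
  have B_events: "B n \<in> events" for n
  proof -
    have "countable (W n)" using W(1) by (rule countable_finite)
    then show ?thesis
      unfolding B_def using Q
      by (intro sets.countable_UN' countable_lists countable_SIGMA) auto
  qed
  have "incseq B"
  proof (intro monoI)
    fix i n :: nat
    assume "i \<le> n"
    then have "W i \<subseteq> W n" by (rule W_mono)
    then have "lists (W i \<times> UNIV) \<subseteq> lists (W n \<times> (UNIV :: nat set))" by (intro lists_mono) auto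
    with \<open>W i \<subseteq> W n\<close> show "B i \<subseteq> B n" unfolding B_def by blast
  qed
  have XK: "R e \<omega> = {X e j \<omega> | j. 0 < X e j \<omega>}" if "\<omega> \<in> space M" "e \<in> parcs G" for \<omega> e
    using X(2) that by simp
  have B_confined: "B n \<subseteq> {\<omega> \<in> space M. \<exists>x. confined_at (parcs G) (W n) (\<lambda>e. R e \<omega>) 0 x t v}" for n
  proof
    fix \<omega> assume "\<omega> \<in> B n"
    then obtain x l where xl: "x \<in> W n" "l \<in> lists (W n \<times> UNIV)" "\<omega> \<in> Q x l" by (auto simp: B_def)
    then have \<omega>: "\<omega> \<in> space M" and ok: "jump_ok G X x l \<omega>" "jump_pos x l = v" "jump_time X x l \<omega> \<le> t"
      and quiet: "\<And>w j. (v, w) \<in> parcs G \<Longrightarrow> \<not> (jump_time X x l \<omega> < X (v, w) j \<omega> \<and> X (v, w) j \<omega> \<le> t)"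
      by (auto simp: Q_def)
    have "fst ` set l \<subseteq> W n" using xl(2) by (auto simp: in_lists_conv_set)
    then have "confined_at (parcs G) (W n) (\<lambda>e. R e \<omega>) 0 x (jump_time X x l \<omega>) v"
      using confined_at_jumps[of G "\<lambda>e. R e \<omega>" X \<omega> x "W n" l] XK[OF \<omega>] xl(1) ok by blast
    moreover have "R (v, w) \<omega> \<inter> {jump_time X x l \<omega><..t} = {}" if "(v, w) \<in> parcs G" for w
      using XK[OF \<omega> that] quiet[OF that] by fastforce
    ultimately have "confined_at (parcs G) (W n) (\<lambda>e. R e \<omega>) 0 x t v"
      using ok(3) by (blast intro: confined_at.stay)
    then show "\<omega> \<in> {\<omega> \<in> space M. \<exists>x. confined_at (parcs G) (W n) (\<lambda>e. R e \<omega>) 0 x t v}"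
      using \<omega> by blast
  qed
  have B_le: "prob (B n) \<le> 2 * N / t + 2 / N" for n
  proof (rule prob_confined_le[OF R _ W(1,2) refl _ _ pos B_confined])
    show "(u, w) \<in> parcs G \<Longrightarrow> (w, u) \<in> parcs G" for u w
      using pair_sym_arcs by (auto simp: symmetric_def sym_def)
    have "{e \<in> parcs G. fst e \<in> W n} = (\<Union>u\<in>W n. out_arcs (with_proj G) u)"
      by (auto simp: out_arcs_def)
    then show "finite {e \<in> parcs G. fst e \<in> W n}"
      using G(3) W[of n] by (auto simp: locally_finite_def)
    show "\<exists>a b. (a, b) \<in> parcs G \<and> a \<in> A \<and> b \<notin> A" if "A \<subseteq> W n" "A \<noteq> {}" for A
      using that W[of n] by (intro boundary_arc G) (auto intro: finite_subset)
  qed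
  have set_l: "fst ` set l \<subseteq> pverts G" if "jump_ok G X x l \<omega>" for x l \<omega>
    using that by (induction l) (auto dest: in_arcsD2)
  \<comment> \<open>A particle reaching \<open>v\<close> has made finitely many jumps, so its start
    and all its stops lie in some \<open>W n\<close>.\<close>
  have "{\<omega> \<in> space M. crw_config G (\<lambda>e. R e \<omega>) t v = 1} \<subseteq> (\<Union>n. B n)"
  proof
    fix \<omega> assume "\<omega> \<in> {\<omega> \<in> space M. crw_config G (\<lambda>e. R e \<omega>) t v = 1}"
    then obtain x where x: "\<omega> \<in> space M" "x \<in> pverts G" "particle_at G (\<lambda>e. R e \<omega>) x t v"
      by (auto simp: crw_config_def split: if_splits)
    then obtain l where l: "\<omega> \<in> Q x l"
      using particle_at_iff_jumps[of x G "\<lambda>e. R e \<omega>" X \<omega> t v] XK unfolding Q_def by blast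
    then have "fst ` set l \<subseteq> pverts G" using set_l unfolding Q_def by blast
    then obtain n where "insert x (fst ` set l) \<subseteq> W n" using W_cover[of "insert x (fst ` set l)"] x by auto
    then have "x \<in> W n" "l \<in> lists (W n \<times> UNIV)" by (auto simp: in_lists_conv_set mem_Times_iff)
    then show "\<omega> \<in> (\<Union>n. B n)" using l by (auto simp: B_def)
  qed
  then have "occupation_prob G R t v \<le> prob (\<Union>n. B n)"
    unfolding occupation_prob_def using B_events by (intro finite_measure_mono) auto
  also have "\<dots> \<le> 2 * real N / t + 2 / real N"
    using finite_Lim_measure_incseq[of B] B_events \<open>incseq B\<close> B_le
    by (intro LIMSEQ_le_const2[of "\<lambda>n. prob (B n)"]) auto
  finally show ?thesis .
qed

theorem mainTheorem4:
  fixes G :: "'v pair_pre_digraph"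
    and M :: "'w measure"
    and R :: "'v \<times> 'v \<Rightarrow> 'w \<Rightarrow> real set"
    and v :: 'v
  assumes "pair_bidirected_digraph G"
    and "infinite (pverts G)"
    and "Digraph_Component.connected (with_proj G)"
    and "locally_finite G"
    and "prob_space M"
    and "prob_space.poisson_clocks M (parcs G) R"
    and "v \<in> pverts G"
  shows "((\<lambda>t. prob_space.occupation_prob M G R t v) \<longlongrightarrow> 0) at_top"
proof -
  interpret prob_space M by fact
  let ?p = "\<lambda>t. occupation_prob G R t v"
  have "\<forall>\<^sub>F t in at_top. ?p t < \<epsilon>" if "0 < \<epsilon>" for \<epsilon> :: real
  proof -
    \<comment> \<open>First \<open>N\<close> makes the cap term \<open>2 / N\<close> less than half
      of \<epsilon>; then \<open>t > 4 * N / \<epsilon>\<close> does the same for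
      \<open>2 * N / t\<close>.\<close>
    obtain N :: nat where N: "4 / \<epsilon> < N" using reals_Archimedean2 by blast
    then have "0 < real N" using that by (meson divide_pos_pos less_trans zero_less_numeral)
    then have "0 < N" by simp
    have 1: "2 / real N < \<epsilon> / 2" using N that \<open>0 < N\<close> by (simp add: field_simps)
    show ?thesis
      using eventually_gt_at_top[of "4 * real N / \<epsilon>"] eventually_gt_at_top[of "0::real"]
    proof eventually_elim
      case (elim t)
      have "2 * real N / t < \<epsilon> / 2" using elim that by (simp add: field_simps)
      moreover have "?p t \<le> 2 * real N / t + 2 / real N"
        using assms \<open>0 < N\<close> elim by (intro occupation_prob_le) auto
      ultimately show ?case using 1 by linarith
    qed
  qed
  moreover have "0 \<le> ?p t" for t by (simp add: occupation_prob_def)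
  ultimately show ?thesis by (intro tendstoI) (simp add: dist_real_def)
qed

end
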